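(* Let $R$ be an associative ring with identity. (1) Let $M$ be a semisimple right $R$-module. If $M$ is strongly ss-injective, then $M$ is small injective. (2) If every simple right $R$-module is strongly ss-injective, then $R$ is semiprimitive, i.e. its Jacobson radical is zero.
   Context: All modules are unitary. A submodule $A$ of a module $N$ is small if $A+L\neq N$ for every proper submodule $L$ of $N$. A right $R$-module $M$ is strongly ss-injective if for every right $R$-module $N$ and every semisimple small submodule $K$ of $N$, every $R$-homomorphism $K\to M$ extends to an $R$-homomorphism $N\to M$. A right $R$-module $M$ is small injective if for every right ideal $I$ of $R$ that is small in $R_R$, every $R$-homomorphism $I\to M$ extends to an $R$-homomorphism $R_R\to M$. *)

theory Defs
  imports "HOL-Algebra.AbelCoset"
begin

section \<open>Right modules\<close>

text \<open>
  The library locale \<open>module\<close> treats left modules over commutative rings only.  As in the library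
  record \<open>module\<close>, the abelian group is the additive part of a \<open>ring\<close> record, whose
  multiplicative fields carry no meaning here.
\<close>

record ('a, 'b) rmodule = "'b ring" +
  rsmult :: "['b, 'a] \<Rightarrow> 'b" (infixl \<open>\<triangleleft>\<index>\<close> 70)

locale right_module = R?: ring R + M?: abelian_group M
  for R :: "('a, 'c) ring_scheme" (structure) and M :: "('a, 'b) rmodule" (structure) +
  assumes rsmult_closed [simp, intro]:
      "\<lbrakk>x \<in> carrier M; r \<in> carrier R\<rbrakk> \<Longrightarrow> x \<triangleleft>\<^bsub>M\<^esub> r \<in> carrier M"
    and rsmult_distr_add:
      "\<lbrakk>x \<in> carrier M; y \<in> carrier M; r \<in> carrier R\<rbrakk> \<Longrightarrow>
        (x \<oplus>\<^bsub>M\<^esub> y) \<triangleleft>\<^bsub>M\<^esub> r = x \<triangleleft>\<^bsub>M\<^esub> r \<oplus>\<^bsub>M\<^esub> y \<triangleleft>\<^bsub>M\<^esub> r"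
    and rsmult_distr_scalar:
      "\<lbrakk>x \<in> carrier M; r \<in> carrier R; s \<in> carrier R\<rbrakk> \<Longrightarrow>
        x \<triangleleft>\<^bsub>M\<^esub> (r \<oplus>\<^bsub>R\<^esub> s) = x \<triangleleft>\<^bsub>M\<^esub> r \<oplus>\<^bsub>M\<^esub> x \<triangleleft>\<^bsub>M\<^esub> s"
    and rsmult_assoc:
      "\<lbrakk>x \<in> carrier M; r \<in> carrier R; s \<in> carrier R\<rbrakk> \<Longrightarrow>
        x \<triangleleft>\<^bsub>M\<^esub> (r \<otimes>\<^bsub>R\<^esub> s) = (x \<triangleleft>\<^bsub>M\<^esub> r) \<triangleleft>\<^bsub>M\<^esub> s"
    and rsmult_one [simp]: "x \<in> carrier M \<Longrightarrow> x \<triangleleft>\<^bsub>M\<^esub> \<one>\<^bsub>R\<^esub> = x"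

text \<open>A submodule \<open>A\<close> of \<open>M\<close>, regarded as a module itself, is \<open>M\<lparr>carrier := A\<rparr>\<close>.\<close>

definition rsubmodule :: "('a, 'c) ring_scheme \<Rightarrow> ('a, 'b) rmodule \<Rightarrow> 'b set \<Rightarrow> bool" where
  "rsubmodule R M A \<longleftrightarrow>
    additive_subgroup A M \<and> (\<forall>x\<in>A. \<forall>r\<in>carrier R. x \<triangleleft>\<^bsub>M\<^esub> r \<in> A)"

definition rmod_hom ::
  "('a, 'c) ring_scheme \<Rightarrow> ('a, 'b) rmodule \<Rightarrow> ('a, 'd) rmodule \<Rightarrow> ('b \<Rightarrow> 'd) set" where
  "rmod_hom R M N =
    {f \<in> carrier M \<rightarrow> carrier N.
      (\<forall>x\<in>carrier M. \<forall>y\<in>carrier M. f (x \<oplus>\<^bsub>M\<^esub> y) = f x \<oplus>\<^bsub>N\<^esub> f y) \<and>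
      (\<forall>x\<in>carrier M. \<forall>r\<in>carrier R. f (x \<triangleleft>\<^bsub>M\<^esub> r) = f x \<triangleleft>\<^bsub>N\<^esub> r)}"

definition right_regular :: "('a, 'c) ring_scheme \<Rightarrow> ('a, 'a) rmodule" where
  "right_regular R =
    \<lparr>carrier = carrier R, mult = mult R, one = one R, zero = zero R, add = add R,
     rsmult = mult R\<rparr>"

abbreviation right_ideal :: "('a, 'c) ring_scheme \<Rightarrow> 'a set \<Rightarrow> bool" where
  "right_ideal R I \<equiv> rsubmodule R (right_regular R) I"

definition small_submodule :: "('a, 'c) ring_scheme \<Rightarrow> ('a, 'b) rmodule \<Rightarrow> 'b set \<Rightarrow> bool" where
  "small_submodule R N A \<longleftrightarrow>
    rsubmodule R N A \<and>
    (\<forall>L. rsubmodule R N L \<and> L \<noteq> carrier N \<longrightarrow> A <+>\<^bsub>N\<^esub> L \<noteq> carrier N)"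

definition simple_rmodule :: "('a, 'c) ring_scheme \<Rightarrow> ('a, 'b) rmodule \<Rightarrow> bool" where
  "simple_rmodule R M \<longleftrightarrow>
    carrier M \<noteq> {\<zero>\<^bsub>M\<^esub>} \<and> (\<forall>A. rsubmodule R M A \<longrightarrow> A = {\<zero>\<^bsub>M\<^esub>} \<or> A = carrier M)"

text \<open>
  The sum of a family of submodules is the least submodule containing all of them; the socle is
  the sum of all simple submodules, and a module is semisimple if it is the sum of its simple
  submodules.
\<close>

definition socle :: "('a, 'c) ring_scheme \<Rightarrow> ('a, 'b) rmodule \<Rightarrow> 'b set" where
  "socle R M =
    \<Inter>{A. rsubmodule R M A \<and>
        (\<forall>S. rsubmodule R M S \<and> simple_rmodule R (M\<lparr>carrier := S\<rparr>) \<longrightarrow> S \<subseteq> A)}"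

definition semisimple_rmodule :: "('a, 'c) ring_scheme \<Rightarrow> ('a, 'b) rmodule \<Rightarrow> bool" where
  "semisimple_rmodule R M \<longleftrightarrow> socle R M = carrier M"

definition maximal_right_ideal :: "('a, 'c) ring_scheme \<Rightarrow> 'a set \<Rightarrow> bool" where
  "maximal_right_ideal R I \<longleftrightarrow>
    right_ideal R I \<and> I \<noteq> carrier R \<and>
    (\<forall>J. right_ideal R J \<and> I \<subseteq> J \<longrightarrow> J = I \<or> J = carrier R)"

definition jacobson_radical :: "('a, 'c) ring_scheme \<Rightarrow> 'a set" where
  "jacobson_radical R = {x \<in> carrier R. \<forall>I. maximal_right_ideal R I \<longrightarrow> x \<in> I}"

definition semiprimitive :: "('a, 'c) ring_scheme \<Rightarrow> bool" where
  "semiprimitive R \<longleftrightarrow> jacobson_radical R = {\<zero>\<^bsub>R\<^esub>}"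


section \<open>Injectivity\<close>

definition hom_extends ::
  "('a, 'c) ring_scheme \<Rightarrow> ('a, 'b) rmodule \<Rightarrow> ('a, 'd) rmodule \<Rightarrow> 'd set \<Rightarrow> bool" where
  "hom_extends R M N K \<longleftrightarrow>
    (\<forall>f \<in> rmod_hom R (N\<lparr>carrier := K\<rparr>) M. \<exists>g \<in> rmod_hom R N M. \<forall>x\<in>K. g x = f x)"

definition ss_injective_wrt ::
  "('a, 'c) ring_scheme \<Rightarrow> ('a, 'b) rmodule \<Rightarrow> ('a, 'd) rmodule \<Rightarrow> bool" where
  "ss_injective_wrt R M N \<longleftrightarrow>
    (\<forall>K. small_submodule R N K \<and> semisimple_rmodule R (N\<lparr>carrier := K\<rparr>) \<longrightarrow> hom_extends R M N K)"

text \<open>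
  The modules \<open>N\<close> in the definition of strong ss-injectivity range over all right \<open>R\<close>-modules.
  A definition can only quantify over the modules with carrier in one type; the type
  \<open>'a \<Rightarrow> 'b\<close> is large enough for nothing to be lost: theorem
  \<open>strongly_ss_injective_all_types\<close> below shows that the extension property then holds for the
  modules \<open>N\<close> over every type.
\<close>

definition strongly_ss_injective :: "('a, 'c) ring_scheme \<Rightarrow> ('a, 'b) rmodule \<Rightarrow> bool" where
  "strongly_ss_injective R M \<longleftrightarrow>
    (\<forall>N :: ('a, 'a \<Rightarrow> 'b) rmodule. right_module R N \<longrightarrow> ss_injective_wrt R M N)"

definition small_injective :: "('a, 'c) ring_scheme \<Rightarrow> ('a, 'b) rmodule \<Rightarrow> bool" where
  "small_injective R M \<longleftrightarrow>
    (\<forall>I. small_submodule R (right_regular R) I \<longrightarrow> hom_extends R M (right_regular R) I)"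


section \<open>Strong ss-injectivity does not depend on the chosen type\<close>

lemma rmod_homD:
  assumes "f \<in> rmod_hom R M N"
  shows "x \<in> carrier M \<Longrightarrow> f x \<in> carrier N"
    and "\<lbrakk>x \<in> carrier M; y \<in> carrier M\<rbrakk> \<Longrightarrow> f (x \<oplus>\<^bsub>M\<^esub> y) = f x \<oplus>\<^bsub>N\<^esub> f y"
    and "\<lbrakk>x \<in> carrier M; r \<in> carrier R\<rbrakk> \<Longrightarrow> f (x \<triangleleft>\<^bsub>M\<^esub> r) = f x \<triangleleft>\<^bsub>N\<^esub> r"
  using assms by (auto simp: rmod_hom_def)

context right_module
begin

lemma rsmult_zero [simp]: "x \<in> carrier M \<Longrightarrow> x \<triangleleft>\<^bsub>M\<^esub> \<zero>\<^bsub>R\<^esub> = \<zero>\<^bsub>M\<^esub>"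
  using rsmult_distr_scalar[of x "\<zero>\<^bsub>R\<^esub>" "\<zero>\<^bsub>R\<^esub>"]
  by (metis M.add.l_cancel_one' R.zero_closed R.l_zero rsmult_closed)

lemma zero_rsmult [simp]: "r \<in> carrier R \<Longrightarrow> \<zero>\<^bsub>M\<^esub> \<triangleleft>\<^bsub>M\<^esub> r = \<zero>\<^bsub>M\<^esub>"
  using rsmult_distr_add[of "\<zero>\<^bsub>M\<^esub>" "\<zero>\<^bsub>M\<^esub>" r]
  by (metis M.add.l_cancel_one' M.zero_closed M.l_zero rsmult_closed)

lemma rsmult_minus_one: "x \<in> carrier M \<Longrightarrow> x \<triangleleft>\<^bsub>M\<^esub> (\<ominus>\<^bsub>R\<^esub> \<one>\<^bsub>R\<^esub>) = \<ominus>\<^bsub>M\<^esub> x"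
proof -
  assume x: "x \<in> carrier M"
  have "x \<triangleleft>\<^bsub>M\<^esub> (\<ominus>\<^bsub>R\<^esub> \<one>\<^bsub>R\<^esub>) \<oplus>\<^bsub>M\<^esub> x = x \<triangleleft>\<^bsub>M\<^esub> (\<ominus>\<^bsub>R\<^esub> \<one>\<^bsub>R\<^esub> \<oplus>\<^bsub>R\<^esub> \<one>\<^bsub>R\<^esub>)"
    using x rsmult_distr_scalar[of x "\<ominus>\<^bsub>R\<^esub> \<one>\<^bsub>R\<^esub>" "\<one>\<^bsub>R\<^esub>"] by simp
  also have "\<dots> = \<zero>\<^bsub>M\<^esub>" using x by (simp add: R.l_neg)
  finally show ?thesis using x by (metis M.minus_equality R.one_closed R.a_inv_closed rsmult_closed)
qed

lemma rsmult_uminus: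
  assumes x: "x \<in> carrier M" and r: "r \<in> carrier R"
  shows "(\<ominus>\<^bsub>M\<^esub> x) \<triangleleft>\<^bsub>M\<^esub> r = \<ominus>\<^bsub>M\<^esub> (x \<triangleleft>\<^bsub>M\<^esub> r)"
proof -
  have "(\<ominus>\<^bsub>M\<^esub> x) \<triangleleft>\<^bsub>M\<^esub> r \<oplus>\<^bsub>M\<^esub> x \<triangleleft>\<^bsub>M\<^esub> r = \<zero>\<^bsub>M\<^esub>"
    using x r rsmult_distr_add[of "\<ominus>\<^bsub>M\<^esub> x" x r] by (simp add: M.l_neg)
  then show ?thesis using x r by (metis M.minus_equality M.a_inv_closed rsmult_closed)
qed

lemma rsmult_diff:
  assumes "x \<in> carrier M" "y \<in> carrier M" "r \<in> carrier R"
  shows "(x \<ominus>\<^bsub>M\<^esub> y) \<triangleleft>\<^bsub>M\<^esub> r = x \<triangleleft>\<^bsub>M\<^esub> r \<ominus>\<^bsub>M\<^esub> y \<triangleleft>\<^bsub>M\<^esub> r"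
  using assms by (simp add: a_minus_def rsmult_distr_add rsmult_uminus)

lemma diff_add_cancel:
  "\<lbrakk>x \<in> carrier M; y \<in> carrier M\<rbrakk> \<Longrightarrow> (x \<ominus>\<^bsub>M\<^esub> y) \<oplus>\<^bsub>M\<^esub> y = x"
  by (simp add: a_minus_def M.a_assoc M.l_neg)

lemma add_diff_cancel:
  "\<lbrakk>x \<in> carrier M; y \<in> carrier M\<rbrakk> \<Longrightarrow> (x \<oplus>\<^bsub>M\<^esub> y) \<ominus>\<^bsub>M\<^esub> x = y"
  using M.a_assoc[of y x "\<ominus>\<^bsub>M\<^esub> x"] by (simp add: a_minus_def M.a_comm[of x y] M.r_neg)

lemma diff_zero [simp]: "x \<in> carrier M \<Longrightarrow> x \<ominus>\<^bsub>M\<^esub> \<zero>\<^bsub>M\<^esub> = x"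
  using diff_add_cancel[of x "\<zero>\<^bsub>M\<^esub>"] by simp

lemma neg_diff:
  "\<lbrakk>x \<in> carrier M; y \<in> carrier M\<rbrakk> \<Longrightarrow> \<ominus>\<^bsub>M\<^esub> (x \<ominus>\<^bsub>M\<^esub> y) = y \<ominus>\<^bsub>M\<^esub> x"
  by (simp add: a_minus_def M.minus_add M.a_comm)

lemma diff_add_diff:
  "\<lbrakk>x \<in> carrier M; y \<in> carrier M; z \<in> carrier M\<rbrakk> \<Longrightarrow>
    (x \<ominus>\<^bsub>M\<^esub> y) \<oplus>\<^bsub>M\<^esub> (y \<ominus>\<^bsub>M\<^esub> z) = x \<ominus>\<^bsub>M\<^esub> z"
  by (simp add: a_minus_def M.a_assoc M.r_neg1)

lemma diff_diff_cancel:
  "\<lbrakk>x \<in> carrier M; y \<in> carrier M; z \<in> carrier M\<rbrakk> \<Longrightarrow>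
    (x \<ominus>\<^bsub>M\<^esub> z) \<ominus>\<^bsub>M\<^esub> (y \<ominus>\<^bsub>M\<^esub> z) = x \<ominus>\<^bsub>M\<^esub> y"
  using diff_add_diff[of x z y] neg_diff[of y z] by (simp add: M.minus_eq)

lemma diff_diff_swap:
  "\<lbrakk>x \<in> carrier M; y \<in> carrier M; z \<in> carrier M; w \<in> carrier M\<rbrakk> \<Longrightarrow>
    (x \<ominus>\<^bsub>M\<^esub> y) \<ominus>\<^bsub>M\<^esub> (z \<ominus>\<^bsub>M\<^esub> w) = (x \<ominus>\<^bsub>M\<^esub> z) \<ominus>\<^bsub>M\<^esub> (y \<ominus>\<^bsub>M\<^esub> w)"
  by (simp add: a_minus_def M.minus_add M.a_ac)

lemma rsubmodule_iff:
  "rsubmodule R M A \<longleftrightarrow>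
    A \<subseteq> carrier M \<and> \<zero>\<^bsub>M\<^esub> \<in> A \<and> (\<forall>x\<in>A. \<forall>y\<in>A. x \<oplus>\<^bsub>M\<^esub> y \<in> A) \<and>
    (\<forall>x\<in>A. \<forall>r\<in>carrier R. x \<triangleleft>\<^bsub>M\<^esub> r \<in> A)" (is "_ \<longleftrightarrow> ?rhs")
proof
  assume "rsubmodule R M A"
  then show ?rhs
    unfolding rsubmodule_def
    using additive_subgroup.a_closed additive_subgroup.a_subset additive_subgroup.zero_closed
    by fast
next
  assume A: ?rhs
  have "\<ominus>\<^bsub>M\<^esub> x \<in> A" if "x \<in> A" for x
    using A that rsmult_minus_one[of x] by (metis R.a_inv_closed R.one_closed subsetD)
  then have "subgroup A (add_monoid M)"
    using A by (intro subgroup.intro) (auto simp: a_inv_def)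
  then show "rsubmodule R M A" using A by (simp add: rsubmodule_def additive_subgroup_def)
qed

lemma rsubmodule_diff:
  assumes "rsubmodule R M A" "x \<in> A" "y \<in> A"
  shows "x \<ominus>\<^bsub>M\<^esub> y \<in> A"
  using assms unfolding rsubmodule_def a_minus_def
  by (meson additive_subgroup.a_closed additive_subgroup.a_inv_closed M.abelian_group_axioms)

lemma rsubmodule_carrier: "rsubmodule R M (carrier M)"
  by (simp add: rsubmodule_iff)

lemma rmod_hom_image:
  assumes f: "f \<in> rmod_hom R M N" and onto: "f ` carrier M = carrier N"
    and zero: "f \<zero>\<^bsub>M\<^esub> = \<zero>\<^bsub>N\<^esub>"
  shows "right_module R N"
proof -
  note f = rmod_homD[OF f]
  have ex: "\<exists>x\<in>carrier M. u = f x" if "u \<in> carrier N" for u using onto that by auto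
  have "abelian_group N"
  proof (rule abelian_groupI)
    show "\<zero>\<^bsub>N\<^esub> \<in> carrier N" using zero f(1) by (metis M.zero_closed)
  next
    fix u v assume "u \<in> carrier N" "v \<in> carrier N"
    then obtain x y where "x \<in> carrier M" "y \<in> carrier M" "u = f x" "v = f y" by (meson ex)
    then show "u \<oplus>\<^bsub>N\<^esub> v \<in> carrier N" "u \<oplus>\<^bsub>N\<^esub> v = v \<oplus>\<^bsub>N\<^esub> u"
      using f by (metis M.add.m_closed, metis M.a_comm)
  next
    fix u v w assume "u \<in> carrier N" "v \<in> carrier N" "w \<in> carrier N"
    then obtain x y z where "x \<in> carrier M" "y \<in> carrier M" "z \<in> carrier M"
      "u = f x" "v = f y" "w = f z" by (meson ex)
    then show "u \<oplus>\<^bsub>N\<^esub> v \<oplus>\<^bsub>N\<^esub> w = u \<oplus>\<^bsub>N\<^esub> (v \<oplus>\<^bsub>N\<^esub> w)"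
      by (simp add: f(2)[symmetric] M.a_assoc)
  next
    fix u assume "u \<in> carrier N"
    then obtain x where x: "x \<in> carrier M" "u = f x" by (meson ex)
    then show "\<zero>\<^bsub>N\<^esub> \<oplus>\<^bsub>N\<^esub> u = u" by (simp add: f(2)[symmetric] zero[symmetric])
    have "f (\<ominus>\<^bsub>M\<^esub> x) \<oplus>\<^bsub>N\<^esub> u = \<zero>\<^bsub>N\<^esub>"
      using x by (simp add: f(2)[symmetric] zero[symmetric] M.l_neg)
    then show "\<exists>v\<in>carrier N. v \<oplus>\<^bsub>N\<^esub> u = \<zero>\<^bsub>N\<^esub>" using x f(1) by (metis M.a_inv_closed)
  qed
  moreover have "right_module_axioms R N"
  proof
    fix u r assume "u \<in> carrier N" and r: "r \<in> carrier R"
    then obtain x where x: "x \<in> carrier M" "u = f x" by (meson ex)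
    show "u \<triangleleft>\<^bsub>N\<^esub> r \<in> carrier N" using x r f by (metis rsmult_closed)
    show "u \<triangleleft>\<^bsub>N\<^esub> (r \<oplus>\<^bsub>R\<^esub> s) = u \<triangleleft>\<^bsub>N\<^esub> r \<oplus>\<^bsub>N\<^esub> u \<triangleleft>\<^bsub>N\<^esub> s" if "s \<in> carrier R" for s
      using x r that by (simp add: f(2,3)[symmetric] rsmult_distr_scalar)
    show "u \<triangleleft>\<^bsub>N\<^esub> (r \<otimes>\<^bsub>R\<^esub> s) = u \<triangleleft>\<^bsub>N\<^esub> r \<triangleleft>\<^bsub>N\<^esub> s" if "s \<in> carrier R" for s
      using x r that by (simp add: f(3)[symmetric] rsmult_assoc)
    show "(u \<oplus>\<^bsub>N\<^esub> v) \<triangleleft>\<^bsub>N\<^esub> r = u \<triangleleft>\<^bsub>N\<^esub> r \<oplus>\<^bsub>N\<^esub> v \<triangleleft>\<^bsub>N\<^esub> r" if "v \<in> carrier N" for v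
    proof -
      obtain y where "y \<in> carrier M" "v = f y" using \<open>v \<in> carrier N\<close> by (meson ex)
      then show ?thesis using x r by (simp add: f(2,3)[symmetric] rsmult_distr_add)
    qed
  next
    fix u assume "u \<in> carrier N"
    then obtain x where x: "x \<in> carrier M" "u = f x" by (meson ex)
    then show "u \<triangleleft>\<^bsub>N\<^esub> \<one>\<^bsub>R\<^esub> = u" by (simp add: f(3)[symmetric])
  qed
  ultimately show ?thesis by (intro right_module.intro R.ring_axioms)
qed

lemma submodule_is_right_module:
  assumes "rsubmodule R M A"
  shows "right_module R (M\<lparr>carrier := A\<rparr>)"
proof -
  have A: "A \<subseteq> carrier M" "\<zero>\<^bsub>M\<^esub> \<in> A" "\<And>x y. x \<in> A \<Longrightarrow> y \<in> A \<Longrightarrow> x \<oplus>\<^bsub>M\<^esub> y \<in> A"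
    "\<And>x r. x \<in> A \<Longrightarrow> r \<in> carrier R \<Longrightarrow> x \<triangleleft>\<^bsub>M\<^esub> r \<in> A"
    using assms by (auto simp: rsubmodule_iff)
  have neg: "\<ominus>\<^bsub>M\<^esub> x \<in> A" if "x \<in> A" for x
    using A that rsmult_minus_one[of x] by (metis R.a_inv_closed R.one_closed subsetD)
  have "\<exists>y\<in>A. y \<oplus>\<^bsub>M\<^esub> x = \<zero>\<^bsub>M\<^esub>" if "x \<in> A" for x
    using A(1) neg[OF that] M.l_neg that by blast
  then have "abelian_group (M\<lparr>carrier := A\<rparr>)"
    using A by (intro abelian_groupI) (auto simp: M.a_ac subset_iff)
  moreover have "right_module_axioms R (M\<lparr>carrier := A\<rparr>)"
    using A by unfold_locales
      (auto simp: rsmult_distr_add rsmult_distr_scalar rsmult_assoc subset_iff)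
  ultimately show ?thesis by (intro right_module.intro R.ring_axioms)
qed

lemma rsubmodule_of_submodule:
  assumes "rsubmodule R M S"
  shows "rsubmodule R (M\<lparr>carrier := S\<rparr>) A \<longleftrightarrow> rsubmodule R M A \<and> A \<subseteq> S"
proof -
  interpret S: right_module R "M\<lparr>carrier := S\<rparr>" using assms by (rule submodule_is_right_module)
  show ?thesis using assms by (auto simp: rsubmodule_iff S.rsubmodule_iff)
qed

lemma rsubmodule_sum:
  assumes "rsubmodule R M A" "rsubmodule R M B"
  shows "rsubmodule R M (A <+>\<^bsub>M\<^esub> B)"
proof -
  have "additive_subgroup (A <+>\<^bsub>M\<^esub> B) M"
    using assms by (simp add: rsubmodule_def M.add_additive_subgroups)
  moreover have "z \<triangleleft>\<^bsub>M\<^esub> r \<in> A <+>\<^bsub>M\<^esub> B" if z: "z \<in> A <+>\<^bsub>M\<^esub> B" and r: "r \<in> carrier R" for z r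
  proof -
    obtain x y where "x \<in> A" "y \<in> B" "z = x \<oplus>\<^bsub>M\<^esub> y"
      using z by (auto simp: set_add_def')
    then have "x \<triangleleft>\<^bsub>M\<^esub> r \<in> A" "y \<triangleleft>\<^bsub>M\<^esub> r \<in> B" "z \<triangleleft>\<^bsub>M\<^esub> r = x \<triangleleft>\<^bsub>M\<^esub> r \<oplus>\<^bsub>M\<^esub> y \<triangleleft>\<^bsub>M\<^esub> r"
      using assms r by (auto simp: rsubmodule_iff rsmult_distr_add subset_iff)
    then show ?thesis unfolding set_add_def' by blast
  qed
  ultimately show ?thesis by (simp add: rsubmodule_def)
qed

lemma rsubmodule_cyclic:
  assumes x: "x \<in> carrier M"
  shows "rsubmodule R M ((\<lambda>r. x \<triangleleft>\<^bsub>M\<^esub> r) ` carrier R)"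
  unfolding rsubmodule_iff using x
  by (auto simp: rsmult_distr_scalar[symmetric] rsmult_assoc[symmetric] intro: image_eqI[where x = "\<zero>\<^bsub>R\<^esub>"])

end

lemma rmod_hom_zero:
  assumes "right_module R M" "right_module R N" "f \<in> rmod_hom R M N"
  shows "f \<zero>\<^bsub>M\<^esub> = \<zero>\<^bsub>N\<^esub>"
proof -
  interpret M: right_module R M by fact
  interpret N: right_module R N by fact
  have "f (\<zero>\<^bsub>M\<^esub> \<triangleleft>\<^bsub>M\<^esub> \<zero>\<^bsub>R\<^esub>) = f \<zero>\<^bsub>M\<^esub> \<triangleleft>\<^bsub>N\<^esub> \<zero>\<^bsub>R\<^esub>"
    using rmod_homD(3)[OF assms(3)] by blast
  then show ?thesis using rmod_homD(1)[OF assms(3)] by simp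
qed

lemma rmod_hom_diff:
  assumes "right_module R M" "right_module R N" "f \<in> rmod_hom R M N"
    and x: "x \<in> carrier M" and y: "y \<in> carrier M"
  shows "f (x \<ominus>\<^bsub>M\<^esub> y) = f x \<ominus>\<^bsub>N\<^esub> f y"
proof -
  interpret M: right_module R M by fact
  interpret N: right_module R N by fact
  note f = rmod_homD[OF assms(3)]
  have "f (\<ominus>\<^bsub>M\<^esub> y) = \<ominus>\<^bsub>N\<^esub> f y"
    using f(1,3) y by (simp add: M.rsmult_minus_one[symmetric] N.rsmult_minus_one[symmetric])
  then show ?thesis using f(2) x y by (simp add: a_minus_def)
qed

lemma rsubmodule_preimage:
  assumes "right_module R M" "right_module R N" "f \<in> rmod_hom R M N" "rsubmodule R N B"
  shows "rsubmodule R M {x \<in> carrier M. f x \<in> B}"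
proof -
  interpret M: right_module R M by fact
  interpret N: right_module R N by fact
  show ?thesis using assms(4) rmod_homD[OF assms(3)] rmod_hom_zero[OF assms(1-3)]
    by (auto simp: M.rsubmodule_iff N.rsubmodule_iff)
qed

lemma rsubmodule_image:
  assumes "right_module R M" "right_module R N" "f \<in> rmod_hom R M N" "rsubmodule R M A"
  shows "rsubmodule R N (f ` A)"
proof -
  interpret M: right_module R M by fact
  interpret N: right_module R N by fact
  have A: "A \<subseteq> carrier M" "\<zero>\<^bsub>M\<^esub> \<in> A" "\<And>x y. x \<in> A \<Longrightarrow> y \<in> A \<Longrightarrow> x \<oplus>\<^bsub>M\<^esub> y \<in> A"
    "\<And>x r. x \<in> A \<Longrightarrow> r \<in> carrier R \<Longrightarrow> x \<triangleleft>\<^bsub>M\<^esub> r \<in> A"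
    using assms(4) by (auto simp: M.rsubmodule_iff)
  note f = rmod_homD[OF assms(3)]
  have "\<zero>\<^bsub>N\<^esub> \<in> f ` A" using A(2) rmod_hom_zero[OF assms(1-3)] by force
  moreover have "f x \<oplus>\<^bsub>N\<^esub> f y \<in> f ` A" if "x \<in> A" "y \<in> A" for x y
    using that A f(2)[of x y] by (metis imageI subsetD)
  moreover have "f x \<triangleleft>\<^bsub>N\<^esub> r \<in> f ` A" if "x \<in> A" "r \<in> carrier R" for x r
    using that A f(3)[of x r] by (metis imageI subsetD)
  ultimately show ?thesis using A(1) f(1) by (auto simp: N.rsubmodule_iff)
qed

lemma small_submodule_image:
  assumes "right_module R M" "right_module R N" "f \<in> rmod_hom R M N"
    and onto: "f ` carrier M = carrier N" and small: "small_submodule R M A"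
  shows "small_submodule R N (f ` A)"
  unfolding small_submodule_def
proof (intro conjI allI impI)
  interpret M: right_module R M by fact
  interpret N: right_module R N by fact
  note f = rmod_homD[OF assms(3)]
  have A: "rsubmodule R M A" using small by (simp add: small_submodule_def)
  then have A_sub: "A \<subseteq> carrier M" by (simp add: M.rsubmodule_iff)
  show "rsubmodule R N (f ` A)" using rsubmodule_image[OF assms(1-3) A] .
  fix B assume B: "rsubmodule R N B \<and> B \<noteq> carrier N"
  then have B_sub: "B \<subseteq> carrier N" by (simp add: N.rsubmodule_iff)
  define L where "L = {x \<in> carrier M. f x \<in> B}"
  have L: "rsubmodule R M L" unfolding L_def using rsubmodule_preimage assms(1-3) B by blast
  have "f ` L = B" using B_sub onto by (auto simp: L_def image_iff)
  then have "L \<noteq> carrier M" using B onto by auto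
  then have ne: "A <+>\<^bsub>M\<^esub> L \<noteq> carrier M" using small L by (simp add: small_submodule_def)
  show "f ` A <+>\<^bsub>N\<^esub> B \<noteq> carrier N"
  proof
    assume eq: "f ` A <+>\<^bsub>N\<^esub> B = carrier N"
    have "x \<in> A <+>\<^bsub>M\<^esub> L" if x: "x \<in> carrier M" for x
    proof -
      have "f x \<in> f ` A <+>\<^bsub>N\<^esub> B" using eq f(1) x by simp
      then obtain a b where ab: "a \<in> A" "b \<in> B" "f x = f a \<oplus>\<^bsub>N\<^esub> b"
        by (auto simp: set_add_def')
      then have c: "a \<in> carrier M" "f a \<in> carrier N" "b \<in> carrier N"
        using A_sub B_sub f(1) by auto
      have "f (x \<ominus>\<^bsub>M\<^esub> a) = b"
        using rmod_hom_diff[OF assms(1-3) x c(1)] ab(3) N.add_diff_cancel[OF c(2,3)] by simp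
      then have "x \<ominus>\<^bsub>M\<^esub> a \<in> L" using x c ab by (simp add: L_def)
      moreover have "x = a \<oplus>\<^bsub>M\<^esub> (x \<ominus>\<^bsub>M\<^esub> a)"
        using x c M.diff_add_cancel[of x a] by (simp add: M.a_comm)
      ultimately show ?thesis using ab by (auto simp: set_add_def')
    qed
    moreover have "A <+>\<^bsub>M\<^esub> L \<subseteq> carrier M"
      using M.rsubmodule_sum[OF A L] by (simp add: M.rsubmodule_iff)
    ultimately show False using ne by blast
  qed
qed

lemma simple_image:
  assumes "right_module R M" "right_module R N" "f \<in> rmod_hom R M N"
    and onto: "f ` carrier M = carrier N" and simple: "simple_rmodule R M"
    and nonzero: "carrier N \<noteq> {\<zero>\<^bsub>N\<^esub>}"
  shows "simple_rmodule R N"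
  unfolding simple_rmodule_def
proof (intro conjI allI impI)
  interpret M: right_module R M by fact
  interpret N: right_module R N by fact
  fix B assume B: "rsubmodule R N B"
  then have "B \<subseteq> carrier N" by (simp add: N.rsubmodule_iff)
  then have im: "f ` {x \<in> carrier M. f x \<in> B} = B" using onto by auto
  have "{x \<in> carrier M. f x \<in> B} = {\<zero>\<^bsub>M\<^esub>} \<or> {x \<in> carrier M. f x \<in> B} = carrier M"
    using rsubmodule_preimage[OF assms(1-3) B] simple by (simp add: simple_rmodule_def)
  then show "B = {\<zero>\<^bsub>N\<^esub>} \<or> B = carrier N"
  proof
    assume "{x \<in> carrier M. f x \<in> B} = {\<zero>\<^bsub>M\<^esub>}"
    then show ?thesis using im rmod_hom_zero[OF assms(1-3)] by simp
  next
    assume "{x \<in> carrier M. f x \<in> B} = carrier M"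
    then show ?thesis using im onto by simp
  qed
qed (rule nonzero)

lemma rmod_hom_restrict:
  assumes "f \<in> rmod_hom R M N" "S \<subseteq> carrier M" "f ` S \<subseteq> T"
  shows "f \<in> rmod_hom R (M\<lparr>carrier := S\<rparr>) (N\<lparr>carrier := T\<rparr>)"
  using assms by (auto simp: rmod_hom_def subset_iff)

lemma semisimple_image:
  assumes "right_module R M" "right_module R N" "f \<in> rmod_hom R M N"
    and onto: "f ` carrier M = carrier N" and ss: "semisimple_rmodule R M"
  shows "semisimple_rmodule R N"
proof -
  interpret M: right_module R M by fact
  interpret N: right_module R N by fact
  note f = rmod_homD[OF assms(3)]
  have "B = carrier N"
    if B: "rsubmodule R N B"
      and BS: "\<And>T. rsubmodule R N T \<Longrightarrow> simple_rmodule R (N\<lparr>carrier := T\<rparr>) \<Longrightarrow> T \<subseteq> B" for B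
  proof -
    define A where "A = {x \<in> carrier M. f x \<in> B}"
    have A: "rsubmodule R M A" unfolding A_def using rsubmodule_preimage[OF assms(1-3) B] .
    have "S \<subseteq> A" if S: "rsubmodule R M S" and simple: "simple_rmodule R (M\<lparr>carrier := S\<rparr>)" for S
    proof -
      have S_sub: "S \<subseteq> carrier M" using S by (simp add: M.rsubmodule_iff)
      have T: "rsubmodule R N (f ` S)" using rsubmodule_image[OF assms(1-3) S] .
      have "f ` S \<subseteq> B"
      proof (cases "f ` S = {\<zero>\<^bsub>N\<^esub>}")
        case True
        then show ?thesis using B by (simp add: N.rsubmodule_iff)
      next
        case False
        have "simple_rmodule R (N\<lparr>carrier := f ` S\<rparr>)"
          using M.submodule_is_right_module[OF S] N.submodule_is_right_module[OF T]
            rmod_hom_restrict[OF assms(3) S_sub order.refl]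
          by (rule simple_image) (use simple False in auto)
        then show ?thesis using BS T by blast
      qed
      then show ?thesis using S_sub by (auto simp: A_def)
    qed
    then have "socle R M \<subseteq> A" using A unfolding socle_def by blast
    then have "A = carrier M" using ss by (auto simp: semisimple_rmodule_def A_def)
    moreover have "B \<subseteq> carrier N" using B by (simp add: N.rsubmodule_iff)
    moreover have "f ` A \<subseteq> B" by (auto simp: A_def)
    ultimately show ?thesis using onto by auto
  qed
  moreover have "T \<subseteq> carrier N" if "rsubmodule R N T" for T
    using that by (simp add: N.rsubmodule_iff)
  ultimately have "socle R N = carrier N"
    unfolding socle_def using N.rsubmodule_carrier by blast
  then show ?thesis by (simp add: semisimple_rmodule_def)
qed

text \<open>Extension problems transport along a surjection whose kernel meets \<open>K\<close> in the kernel of \<open>f\<close>.\<close>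

lemma extend_along_surjection:
  assumes N: "right_module R N" and N': "right_module R N'" and M: "right_module R M"
    and h: "h \<in> rmod_hom R N N'" and onto: "h ` carrier N = carrier N'"
    and K: "small_submodule R N K" "semisimple_rmodule R (N\<lparr>carrier := K\<rparr>)"
    and f: "f \<in> rmod_hom R (N\<lparr>carrier := K\<rparr>) M"
    and ker: "\<And>x. x \<in> K \<Longrightarrow> h x = \<zero>\<^bsub>N'\<^esub> \<Longrightarrow> f x = \<zero>\<^bsub>M\<^esub>"
    and inj: "ss_injective_wrt R M N'"
  shows "\<exists>g \<in> rmod_hom R N M. \<forall>x\<in>K. g x = f x"
proof -
  interpret N: right_module R N by fact
  interpret N': right_module R N' by fact
  interpret M: right_module R M by fact
  have Ksub: "rsubmodule R N K" using K by (simp add: small_submodule_def)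
  then have Kc: "K \<subseteq> carrier N" and Kadd: "\<And>x y. x \<in> K \<Longrightarrow> y \<in> K \<Longrightarrow> x \<oplus>\<^bsub>N\<^esub> y \<in> K"
    and Ksm: "\<And>x r. x \<in> K \<Longrightarrow> r \<in> carrier R \<Longrightarrow> x \<triangleleft>\<^bsub>N\<^esub> r \<in> K"
    by (auto simp: N.rsubmodule_iff)
  have NK: "right_module R (N\<lparr>carrier := K\<rparr>)" using N.submodule_is_right_module[OF Ksub] .
  note hD = rmod_homD[OF h]
  have fD: "\<And>x. x \<in> K \<Longrightarrow> f x \<in> carrier M"
    "\<And>x y. x \<in> K \<Longrightarrow> y \<in> K \<Longrightarrow> f (x \<oplus>\<^bsub>N\<^esub> y) = f x \<oplus>\<^bsub>M\<^esub> f y"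
    "\<And>x r. x \<in> K \<Longrightarrow> r \<in> carrier R \<Longrightarrow> f (x \<triangleleft>\<^bsub>N\<^esub> r) = f x \<triangleleft>\<^bsub>M\<^esub> r"
    using rmod_homD[OF f] by auto
  let ?K = "h ` K"
  have K'sub: "rsubmodule R N' ?K" using rsubmodule_image[OF N N' h Ksub] .
  have "small_submodule R N' ?K" using small_submodule_image[OF N N' h onto K(1)] .
  moreover have "semisimple_rmodule R (N'\<lparr>carrier := ?K\<rparr>)"
    using NK N'.submodule_is_right_module[OF K'sub] rmod_hom_restrict[OF h Kc order.refl]
    by (rule semisimple_image) (use K in auto)
  ultimately have ext: "hom_extends R M N' ?K" using inj by (simp add: ss_injective_wrt_def)
  have eq: "f x = f y" if xy: "x \<in> K" "y \<in> K" "h x = h y" for x y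
  proof -
    have c: "x \<in> carrier N" "y \<in> carrier N" using xy Kc by auto
    have d: "x \<ominus>\<^bsub>N\<^esub> y \<in> K" using N.rsubmodule_diff[OF Ksub] xy by blast
    have "h (x \<ominus>\<^bsub>N\<^esub> y) = \<zero>\<^bsub>N'\<^esub>"
      using rmod_hom_diff[OF N N' h c] xy hD(1)[OF c(2)] by (simp add: a_minus_def N'.r_neg)
    then have z: "f (x \<ominus>\<^bsub>N\<^esub> y) = \<zero>\<^bsub>M\<^esub>" using ker d by blast
    have "x = (x \<ominus>\<^bsub>N\<^esub> y) \<oplus>\<^bsub>N\<^esub> y" using c by (simp add: N.diff_add_cancel)
    then have "f x = f (x \<ominus>\<^bsub>N\<^esub> y) \<oplus>\<^bsub>M\<^esub> f y" using fD(2)[OF d xy(2)] by simp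
    then show ?thesis using z fD(1)[OF xy(2)] by simp
  qed
  define f' where "f' u = f (SOME x. x \<in> K \<and> h x = u)" for u
  have f'_h: "f' (h x) = f x" if "x \<in> K" for x
    unfolding f'_def using eq that by (metis (mono_tags, lifting) someI_ex)
  have "f' (h x \<oplus>\<^bsub>N'\<^esub> h y) = f' (h x) \<oplus>\<^bsub>M\<^esub> f' (h y)" if "x \<in> K" "y \<in> K" for x y
  proof -
    have "h x \<oplus>\<^bsub>N'\<^esub> h y = h (x \<oplus>\<^bsub>N\<^esub> y)" using hD(2) that Kc by (simp add: subset_iff)
    then show ?thesis using f'_h Kadd fD(2) that by simp
  qed
  moreover have "f' (h x \<triangleleft>\<^bsub>N'\<^esub> r) = f' (h x) \<triangleleft>\<^bsub>M\<^esub> r" if "x \<in> K" "r \<in> carrier R" for x r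
  proof -
    have "h x \<triangleleft>\<^bsub>N'\<^esub> r = h (x \<triangleleft>\<^bsub>N\<^esub> r)" using hD(3) that Kc by (simp add: subset_iff)
    then show ?thesis using f'_h Ksm fD(3) that by simp
  qed
  ultimately have "f' \<in> rmod_hom R (N'\<lparr>carrier := ?K\<rparr>) M"
    using f'_h fD(1) by (auto simp: rmod_hom_def)
  then obtain g where g: "g \<in> rmod_hom R N' M" "\<And>x. x \<in> K \<Longrightarrow> g (h x) = f' (h x)"
    using ext by (auto simp: hom_extends_def)
  have "g \<circ> h \<in> rmod_hom R N M"
    using rmod_homD[OF g(1)] hD by (auto simp: rmod_hom_def)
  then show ?thesis using g(2) f'_h by (metis comp_apply)
qed

text \<open>
  A map on \<open>N\<close> whose fibres are the cosets of a submodule is onto a module: transport of structure.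
\<close>

lemma fibres_cosets_module:
  fixes N :: "('a, 'd) rmodule" and p :: "'d \<Rightarrow> 'e"
  assumes N: "right_module R N" and L: "rsubmodule R N L"
    and p: "\<And>x y. x \<in> carrier N \<Longrightarrow> y \<in> carrier N \<Longrightarrow> p x = p y \<longleftrightarrow> x \<ominus>\<^bsub>N\<^esub> y \<in> L"
  obtains N' :: "('a, 'e) rmodule" where "right_module R N'" "p \<in> rmod_hom R N N'"
    "p ` carrier N = carrier N'" "p \<zero>\<^bsub>N\<^esub> = \<zero>\<^bsub>N'\<^esub>"
proof -
  interpret N: right_module R N by fact
  have Lc: "L \<subseteq> carrier N" and Ladd: "\<And>x y. x \<in> L \<Longrightarrow> y \<in> L \<Longrightarrow> x \<oplus>\<^bsub>N\<^esub> y \<in> L"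
    and Lsm: "\<And>x r. x \<in> L \<Longrightarrow> r \<in> carrier R \<Longrightarrow> x \<triangleleft>\<^bsub>N\<^esub> r \<in> L"
    using L by (auto simp: N.rsubmodule_iff)
  define s where "s u = (SOME x. x \<in> carrier N \<and> p x = u)" for u
  have s: "s (p x) \<in> carrier N \<and> p (s (p x)) = p x" if "x \<in> carrier N" for x
    unfolding s_def using that by (metis (mono_tags, lifting) someI_ex)
  define N' :: "('a, 'e) rmodule" where
    "N' = \<lparr>carrier = p ` carrier N, mult = undefined, one = undefined, zero = p \<zero>\<^bsub>N\<^esub>,
      add = (\<lambda>u v. p (s u \<oplus>\<^bsub>N\<^esub> s v)), rsmult = (\<lambda>u r. p (s u \<triangleleft>\<^bsub>N\<^esub> r))\<rparr>"
  have add: "p (s (p x) \<oplus>\<^bsub>N\<^esub> s (p y)) = p (x \<oplus>\<^bsub>N\<^esub> y)"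
    if x: "x \<in> carrier N" and y: "y \<in> carrier N" for x y
  proof -
    have c: "s (p x) \<in> carrier N" "s (p y) \<in> carrier N" using s x y by auto
    have "s (p x) \<ominus>\<^bsub>N\<^esub> x \<in> L" "s (p y) \<ominus>\<^bsub>N\<^esub> y \<in> L" using s x y p by blast+
    then have "(s (p x) \<ominus>\<^bsub>N\<^esub> x) \<oplus>\<^bsub>N\<^esub> (s (p y) \<ominus>\<^bsub>N\<^esub> y) \<in> L" using Ladd by blast
    moreover have "(s (p x) \<ominus>\<^bsub>N\<^esub> x) \<oplus>\<^bsub>N\<^esub> (s (p y) \<ominus>\<^bsub>N\<^esub> y) =
        (s (p x) \<oplus>\<^bsub>N\<^esub> s (p y)) \<ominus>\<^bsub>N\<^esub> (x \<oplus>\<^bsub>N\<^esub> y)"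
      using c x y by (simp add: a_minus_def N.a_ac N.minus_add)
    ultimately show ?thesis using p c x y by simp
  qed
  have sm: "p (s (p x) \<triangleleft>\<^bsub>N\<^esub> r) = p (x \<triangleleft>\<^bsub>N\<^esub> r)" if x: "x \<in> carrier N" and r: "r \<in> carrier R" for x r
  proof -
    have c: "s (p x) \<in> carrier N" using s x by auto
    have "s (p x) \<ominus>\<^bsub>N\<^esub> x \<in> L" using s x p by blast
    then have "(s (p x) \<ominus>\<^bsub>N\<^esub> x) \<triangleleft>\<^bsub>N\<^esub> r \<in> L" using Lsm r by blast
    then show ?thesis using p c x r by (simp add: N.rsmult_diff)
  qed
  have hom: "p \<in> rmod_hom R N N'" using add sm by (auto simp: rmod_hom_def N'_def)
  have onto: "p ` carrier N = carrier N'" and zero: "p \<zero>\<^bsub>N\<^esub> = \<zero>\<^bsub>N'\<^esub>"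
    by (simp_all add: N'_def)
  have "right_module R N'" using N.rmod_hom_image[OF hom onto zero] .
  then show ?thesis using that hom onto zero by blast
qed

text \<open>
  A maximal submodule among those meeting \<open>K\<close> in \<open>L0\<close>; modulo it, \<open>K\<close> becomes essential.
\<close>

lemma relative_complement:
  assumes N: "right_module R N" and K: "rsubmodule R N K"
    and L0: "rsubmodule R N L0" "L0 \<subseteq> K"
  obtains L where "rsubmodule R N L" "L \<inter> K = L0"
    "\<And>x. x \<in> carrier N \<Longrightarrow> x \<notin> L \<Longrightarrow>
      \<exists>r\<in>carrier R. \<exists>y\<in>K - L0. x \<triangleleft>\<^bsub>N\<^esub> r \<ominus>\<^bsub>N\<^esub> y \<in> L"
proof -
  interpret N: right_module R N by fact
  define F where "F = {L. rsubmodule R N L \<and> L \<inter> K = L0}"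
  have "\<exists>L\<in>F. \<forall>X\<in>F. L \<subseteq> X \<longrightarrow> X = L"
  proof (rule subset_Zorn_nonempty)
    show "F \<noteq> {}" using L0 by (auto simp: F_def)
    fix C assume ne: "C \<noteq> {}" and chain: "subset.chain F C"
    have CF: "\<And>L. L \<in> C \<Longrightarrow> rsubmodule R N L \<and> L \<inter> K = L0"
      and lin: "\<And>X Y. X \<in> C \<Longrightarrow> Y \<in> C \<Longrightarrow> X \<subseteq> Y \<or> Y \<subseteq> X"
      using chain unfolding subset.chain_def F_def by blast+
    have "x \<oplus>\<^bsub>N\<^esub> y \<in> \<Union>C" if xy: "x \<in> \<Union>C" "y \<in> \<Union>C" for x y
    proof -
      obtain X Y where XY: "X \<in> C" "x \<in> X" "Y \<in> C" "y \<in> Y" using xy by blast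
      then obtain Z where "Z \<in> C" "x \<in> Z" "y \<in> Z" using lin[of X Y] by blast
      then show ?thesis using CF[of Z] by (auto simp: N.rsubmodule_iff)
    qed
    moreover have "\<Union>C \<subseteq> carrier N" "\<zero>\<^bsub>N\<^esub> \<in> \<Union>C"
      using CF ne unfolding N.rsubmodule_iff by blast+
    moreover have "x \<triangleleft>\<^bsub>N\<^esub> r \<in> \<Union>C" if "x \<in> \<Union>C" "r \<in> carrier R" for x r
      using that CF unfolding N.rsubmodule_iff by blast
    ultimately have "rsubmodule R N (\<Union>C)" by (simp add: N.rsubmodule_iff)
    then show "\<Union>C \<in> F" using CF ne by (auto simp: F_def)
  qed
  then obtain L where L: "rsubmodule R N L" "L \<inter> K = L0"
    and max: "\<And>X. rsubmodule R N X \<Longrightarrow> X \<inter> K = L0 \<Longrightarrow> L \<subseteq> X \<Longrightarrow> X = L"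
    by (auto simp: F_def)
  have Lc: "L \<subseteq> carrier N" "\<zero>\<^bsub>N\<^esub> \<in> L" using L by (auto simp: N.rsubmodule_iff)
  have "\<exists>r\<in>carrier R. \<exists>y\<in>K - L0. x \<triangleleft>\<^bsub>N\<^esub> r \<ominus>\<^bsub>N\<^esub> y \<in> L" if x: "x \<in> carrier N" "x \<notin> L" for x
  proof -
    define X where "X = L <+>\<^bsub>N\<^esub> ((\<lambda>r. x \<triangleleft>\<^bsub>N\<^esub> r) ` carrier R)"
    have X: "rsubmodule R N X"
      unfolding X_def using N.rsubmodule_sum[OF L(1) N.rsubmodule_cyclic[OF x(1)]] .
    have X_iff: "z \<in> X \<longleftrightarrow> (\<exists>l\<in>L. \<exists>r\<in>carrier R. z = l \<oplus>\<^bsub>N\<^esub> x \<triangleleft>\<^bsub>N\<^esub> r)" for z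
      unfolding X_def set_add_def' by blast
    have "L \<subseteq> X"
    proof
      fix l assume "l \<in> L"
      then have "l = l \<oplus>\<^bsub>N\<^esub> x \<triangleleft>\<^bsub>N\<^esub> \<zero>\<^bsub>R\<^esub>" using x Lc by auto
      then show "l \<in> X" using \<open>l \<in> L\<close> X_iff by blast
    qed
    moreover have "x \<in> X"
    proof -
      have "x = \<zero>\<^bsub>N\<^esub> \<oplus>\<^bsub>N\<^esub> x \<triangleleft>\<^bsub>N\<^esub> \<one>\<^bsub>R\<^esub>" using x by simp
      then show ?thesis using Lc X_iff by blast
    qed
    ultimately have "X \<inter> K \<noteq> L0" using max[OF X] x by blast
    then obtain y where y: "y \<in> K" "y \<notin> L0" "y \<in> X" using \<open>L \<subseteq> X\<close> L(2) by blast
    then obtain l r where lr: "l \<in> L" "r \<in> carrier R" "y = l \<oplus>\<^bsub>N\<^esub> x \<triangleleft>\<^bsub>N\<^esub> r"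
      using X_iff by blast
    have c: "l \<in> carrier N" "x \<triangleleft>\<^bsub>N\<^esub> r \<in> carrier N" using lr Lc x by auto
    have "y \<ominus>\<^bsub>N\<^esub> x \<triangleleft>\<^bsub>N\<^esub> r = l"
      unfolding lr(3) N.a_comm[OF c] using c(2,1) by (rule N.add_diff_cancel)
    then have "x \<triangleleft>\<^bsub>N\<^esub> r \<ominus>\<^bsub>N\<^esub> y = \<ominus>\<^bsub>N\<^esub> l"
      using N.neg_diff[of y "x \<triangleleft>\<^bsub>N\<^esub> r"] y(1) c(2) K by (auto simp: N.rsubmodule_iff)
    then have "x \<triangleleft>\<^bsub>N\<^esub> r \<ominus>\<^bsub>N\<^esub> y \<in> L"
      using N.rsubmodule_diff[OF L(1) Lc(2) lr(1)] c(1) by (simp add: N.minus_eq[of "\<zero>\<^bsub>N\<^esub>"])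
    then show ?thesis using lr y by blast
  qed
  then show ?thesis using that L by blast
qed

theorem strongly_ss_injective_all_types:
  fixes R :: "('a, 'c) ring_scheme" and M :: "('a, 'b) rmodule" and N :: "('a, 'd) rmodule"
  assumes M: "right_module R M" and inj: "strongly_ss_injective R M" and N: "right_module R N"
  shows "ss_injective_wrt R M N"
  unfolding ss_injective_wrt_def hom_extends_def
proof (intro allI impI ballI, elim conjE)
  interpret N: right_module R N by fact
  interpret M: right_module R M by fact
  fix K f
  assume small: "small_submodule R N K" and ss: "semisimple_rmodule R (N\<lparr>carrier := K\<rparr>)"
    and f: "f \<in> rmod_hom R (N\<lparr>carrier := K\<rparr>) M"
  have K: "rsubmodule R N K" using small by (simp add: small_submodule_def)
  then have Kc: "K \<subseteq> carrier N" and K0: "\<zero>\<^bsub>N\<^esub> \<in> K" by (auto simp: N.rsubmodule_iff)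
  have NK: "right_module R (N\<lparr>carrier := K\<rparr>)" using N.submodule_is_right_module[OF K] .
  interpret NK: right_module R "N\<lparr>carrier := K\<rparr>" by fact
  have fD: "\<And>x. x \<in> K \<Longrightarrow> f x \<in> carrier M"
    "\<And>x y. x \<in> K \<Longrightarrow> y \<in> K \<Longrightarrow> f (x \<oplus>\<^bsub>N\<^esub> y) = f x \<oplus>\<^bsub>M\<^esub> f y"
    using rmod_homD[OF f] by auto
  have f_eq: "f x = f y \<longleftrightarrow> f (x \<ominus>\<^bsub>N\<^esub> y) = \<zero>\<^bsub>M\<^esub>" if xy: "x \<in> K" "y \<in> K" for x y
  proof -
    have c: "x \<in> carrier N" "y \<in> carrier N" using xy Kc by auto
    have d: "x \<ominus>\<^bsub>N\<^esub> y \<in> K" using N.rsubmodule_diff[OF K] xy by blast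
    have "x = (x \<ominus>\<^bsub>N\<^esub> y) \<oplus>\<^bsub>N\<^esub> y" using c by (simp add: N.diff_add_cancel)
    then have "f x = f (x \<ominus>\<^bsub>N\<^esub> y) \<oplus>\<^bsub>M\<^esub> f y" using fD(2)[OF d xy(2)] by simp
    then show ?thesis using fD(1)[OF d] fD(1)[OF xy(2)] by simp
  qed
  define L0 where "L0 = {x \<in> K. f x = \<zero>\<^bsub>M\<^esub>}"
  have "rsubmodule R M {\<zero>\<^bsub>M\<^esub>}" by (simp add: M.rsubmodule_iff)
  from rsubmodule_preimage[OF NK M f this]
  have L0: "rsubmodule R N L0" by (simp add: L0_def N.rsubmodule_of_submodule[OF K])
  have L0K: "L0 \<subseteq> K" by (auto simp: L0_def)
  obtain L where L: "rsubmodule R N L" "L \<inter> K = L0"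
    and ess: "\<And>x. x \<in> carrier N \<Longrightarrow> x \<notin> L \<Longrightarrow>
      \<exists>r\<in>carrier R. \<exists>y\<in>K - L0. x \<triangleleft>\<^bsub>N\<^esub> r \<ominus>\<^bsub>N\<^esub> y \<in> L"
    using relative_complement[OF N K L0 L0K] by blast
  have Lc: "L \<subseteq> carrier N" "\<zero>\<^bsub>N\<^esub> \<in> L"
    and Ladd: "\<And>x y. x \<in> L \<Longrightarrow> y \<in> L \<Longrightarrow> x \<oplus>\<^bsub>N\<^esub> y \<in> L"
    using L by (auto simp: N.rsubmodule_iff)
  text \<open>
    Choose a representative \<open>c z\<close> of each coset \<open>z + (K + L)\<close>; then \<open>v z\<close> is the value at
    \<open>z - c z\<close> of the homomorphism on \<open>K + L\<close> that extends \<open>f\<close> by zero on \<open>L\<close>.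
  \<close>
  define D where "D = K <+>\<^bsub>N\<^esub> L"
  have D: "rsubmodule R N D" unfolding D_def using N.rsubmodule_sum[OF K L(1)] .
  have KD: "K \<subseteq> D"
  proof
    fix k assume "k \<in> K"
    then have "k = k \<oplus>\<^bsub>N\<^esub> \<zero>\<^bsub>N\<^esub>" using Kc by auto
    then show "k \<in> D" using \<open>k \<in> K\<close> Lc unfolding D_def set_add_def' by blast
  qed
  have LD: "L \<subseteq> D"
  proof
    fix l assume "l \<in> L"
    then have "l = \<zero>\<^bsub>N\<^esub> \<oplus>\<^bsub>N\<^esub> l" using Lc by auto
    then show "l \<in> D" using \<open>l \<in> L\<close> K0 unfolding D_def set_add_def' by blast
  qed
  define c where "c z = (SOME w. w \<in> carrier N \<and> z \<ominus>\<^bsub>N\<^esub> w \<in> D)" for z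
  have c: "c z \<in> carrier N" "z \<ominus>\<^bsub>N\<^esub> c z \<in> D" if "z \<in> carrier N" for z
  proof -
    have "z \<ominus>\<^bsub>N\<^esub> z \<in> D" using that D by (simp add: N.rsubmodule_iff a_minus_def N.r_neg)
    then have "\<exists>w. w \<in> carrier N \<and> z \<ominus>\<^bsub>N\<^esub> w \<in> D" using that by blast
    from someI_ex[OF this] show "c z \<in> carrier N" "z \<ominus>\<^bsub>N\<^esub> c z \<in> D" by (auto simp: c_def)
  qed
  have c_eq: "c z = c w" if z: "z \<in> carrier N" and w: "w \<in> carrier N" and d: "z \<ominus>\<^bsub>N\<^esub> w \<in> D" for z w
  proof -
    have "w \<ominus>\<^bsub>N\<^esub> z \<in> D"
      using N.rsubmodule_diff[OF D _ d, of "\<zero>\<^bsub>N\<^esub>"] D z w N.neg_diff[of z w]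
      by (simp add: N.rsubmodule_iff N.minus_eq[of "\<zero>\<^bsub>N\<^esub>"])
    then have "z \<ominus>\<^bsub>N\<^esub> e \<in> D \<longleftrightarrow> w \<ominus>\<^bsub>N\<^esub> e \<in> D" if "e \<in> carrier N" for e
      using D d N.diff_add_diff[OF z w that] N.diff_add_diff[OF w z that] by (metis N.rsubmodule_iff)
    then show ?thesis unfolding c_def by meson
  qed
  define k where "k z = (SOME y. y \<in> K \<and> (z \<ominus>\<^bsub>N\<^esub> c z) \<ominus>\<^bsub>N\<^esub> y \<in> L)" for z
  have k: "k z \<in> K" "(z \<ominus>\<^bsub>N\<^esub> c z) \<ominus>\<^bsub>N\<^esub> k z \<in> L" if z: "z \<in> carrier N" for z
  proof -
    obtain y l where yl: "y \<in> K" "l \<in> L" "z \<ominus>\<^bsub>N\<^esub> c z = y \<oplus>\<^bsub>N\<^esub> l"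
      using c(2)[OF z] by (auto simp: D_def set_add_def')
    have "(y \<oplus>\<^bsub>N\<^esub> l) \<ominus>\<^bsub>N\<^esub> y = l"
      using yl Kc Lc by (intro N.add_diff_cancel) auto
    then have "\<exists>y. y \<in> K \<and> (z \<ominus>\<^bsub>N\<^esub> c z) \<ominus>\<^bsub>N\<^esub> y \<in> L" using yl by auto
    from someI_ex[OF this] show "k z \<in> K" "(z \<ominus>\<^bsub>N\<^esub> c z) \<ominus>\<^bsub>N\<^esub> k z \<in> L"
      by (auto simp: k_def)
  qed
  define v where "v z = f (k z)" for z
  have v_eq: "v z = v w \<longleftrightarrow> y \<in> L0"
    if z: "z \<in> carrier N" and w: "w \<in> carrier N" and y: "y \<in> K" and d: "(z \<ominus>\<^bsub>N\<^esub> w) \<ominus>\<^bsub>N\<^esub> y \<in> L"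
    for z w y
  proof -
    have yc: "y \<in> carrier N" using y Kc by auto
    have "z \<ominus>\<^bsub>N\<^esub> w = ((z \<ominus>\<^bsub>N\<^esub> w) \<ominus>\<^bsub>N\<^esub> y) \<oplus>\<^bsub>N\<^esub> y"
      using z w yc by (simp add: a_minus_def N.a_assoc N.l_neg)
    moreover have "((z \<ominus>\<^bsub>N\<^esub> w) \<ominus>\<^bsub>N\<^esub> y) \<oplus>\<^bsub>N\<^esub> y \<in> D"
      using D LD KD d y by (simp add: N.rsubmodule_iff subset_iff)
    ultimately have "c z = c w" using c_eq[OF z w] by metis
    have kc: "k z \<in> carrier N" "k w \<in> carrier N" using k(1) z w Kc by auto
    have dk: "k z \<ominus>\<^bsub>N\<^esub> k w \<in> K" using N.rsubmodule_diff[OF K] k(1) z w by blast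
    have "((z \<ominus>\<^bsub>N\<^esub> c z) \<ominus>\<^bsub>N\<^esub> k z) \<ominus>\<^bsub>N\<^esub> ((w \<ominus>\<^bsub>N\<^esub> c w) \<ominus>\<^bsub>N\<^esub> k w) \<in> L" (is "?e \<in> L")
      using N.rsubmodule_diff[OF L(1)] k(2) z w by blast
    moreover have "?e = (z \<ominus>\<^bsub>N\<^esub> w) \<ominus>\<^bsub>N\<^esub> (k z \<ominus>\<^bsub>N\<^esub> k w)"
      using z w kc c(1)[OF w] \<open>c z = c w\<close>
        N.diff_diff_swap[of "z \<ominus>\<^bsub>N\<^esub> c w" "k z" "w \<ominus>\<^bsub>N\<^esub> c w" "k w"]
      by (simp add: N.diff_diff_cancel)
    ultimately have "((z \<ominus>\<^bsub>N\<^esub> w) \<ominus>\<^bsub>N\<^esub> (k z \<ominus>\<^bsub>N\<^esub> k w)) \<ominus>\<^bsub>N\<^esub> ((z \<ominus>\<^bsub>N\<^esub> w) \<ominus>\<^bsub>N\<^esub> y) \<in> L"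
      using N.rsubmodule_diff[OF L(1)] d by metis
    moreover have "((z \<ominus>\<^bsub>N\<^esub> w) \<ominus>\<^bsub>N\<^esub> (k z \<ominus>\<^bsub>N\<^esub> k w)) \<ominus>\<^bsub>N\<^esub> ((z \<ominus>\<^bsub>N\<^esub> w) \<ominus>\<^bsub>N\<^esub> y)
        = y \<ominus>\<^bsub>N\<^esub> (k z \<ominus>\<^bsub>N\<^esub> k w)"
      using z w kc yc N.neg_diff[of "k z \<ominus>\<^bsub>N\<^esub> k w" y]
      by (simp add: N.diff_diff_swap[of "z \<ominus>\<^bsub>N\<^esub> w"])
        (simp add: N.minus_eq N.r_neg)
    ultimately have "y \<ominus>\<^bsub>N\<^esub> (k z \<ominus>\<^bsub>N\<^esub> k w) \<in> L0"
      using L(2) N.rsubmodule_diff[OF K y dk] by auto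
    then have "f y = f (k z \<ominus>\<^bsub>N\<^esub> k w)" using f_eq[OF y dk] by (simp add: L0_def)
    then show ?thesis using f_eq[of "k z" "k w"] k(1) z w y by (simp add: v_def L0_def)
  qed
  define p where "p x = (\<lambda>r. if r \<in> carrier R then v (x \<triangleleft>\<^bsub>N\<^esub> r) else undefined)" for x
  have p: "p x = p y \<longleftrightarrow> x \<ominus>\<^bsub>N\<^esub> y \<in> L" if x: "x \<in> carrier N" and y: "y \<in> carrier N" for x y
  proof
    assume d: "x \<ominus>\<^bsub>N\<^esub> y \<in> L"
    have "v (x \<triangleleft>\<^bsub>N\<^esub> r) = v (y \<triangleleft>\<^bsub>N\<^esub> r)" if r: "r \<in> carrier R" for r
    proof -
      have "(x \<ominus>\<^bsub>N\<^esub> y) \<triangleleft>\<^bsub>N\<^esub> r \<in> L" using d r L(1) by (simp add: N.rsubmodule_iff)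
      then have "(x \<triangleleft>\<^bsub>N\<^esub> r \<ominus>\<^bsub>N\<^esub> y \<triangleleft>\<^bsub>N\<^esub> r) \<ominus>\<^bsub>N\<^esub> \<zero>\<^bsub>N\<^esub> \<in> L"
        using x y r by (simp add: N.rsmult_diff)
      moreover have "\<zero>\<^bsub>N\<^esub> \<in> L0" using L0 by (simp add: N.rsubmodule_iff)
      ultimately show ?thesis using v_eq[of "x \<triangleleft>\<^bsub>N\<^esub> r" "y \<triangleleft>\<^bsub>N\<^esub> r" "\<zero>\<^bsub>N\<^esub>"] x y r K0 by simp
    qed
    then show "p x = p y" by (auto simp: p_def)
  next
    assume eq: "p x = p y"
    show "x \<ominus>\<^bsub>N\<^esub> y \<in> L"
    proof (rule ccontr)
      assume "x \<ominus>\<^bsub>N\<^esub> y \<notin> L"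
      then obtain r a where ra: "r \<in> carrier R" "a \<in> K" "a \<notin> L0"
        "(x \<ominus>\<^bsub>N\<^esub> y) \<triangleleft>\<^bsub>N\<^esub> r \<ominus>\<^bsub>N\<^esub> a \<in> L"
        using ess[of "x \<ominus>\<^bsub>N\<^esub> y"] x y by auto
      then have "v (x \<triangleleft>\<^bsub>N\<^esub> r) \<noteq> v (y \<triangleleft>\<^bsub>N\<^esub> r)"
        using v_eq[of "x \<triangleleft>\<^bsub>N\<^esub> r" "y \<triangleleft>\<^bsub>N\<^esub> r" a] x y by (simp add: N.rsmult_diff)
      moreover have "v (x \<triangleleft>\<^bsub>N\<^esub> r) = v (y \<triangleleft>\<^bsub>N\<^esub> r)"
        using fun_cong[OF eq, of r] ra(1) by (simp add: p_def)
      ultimately show False by blast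
    qed
  qed
  obtain N' :: "('a, 'a \<Rightarrow> 'b) rmodule" where N': "right_module R N'" "p \<in> rmod_hom R N N'"
    "p ` carrier N = carrier N'" "p \<zero>\<^bsub>N\<^esub> = \<zero>\<^bsub>N'\<^esub>"
    using fibres_cosets_module[OF N L(1) p] by blast
  have ker: "f x = \<zero>\<^bsub>M\<^esub>" if x: "x \<in> K" "p x = \<zero>\<^bsub>N'\<^esub>" for x
  proof -
    have "x \<in> carrier N" using x Kc by auto
    then have "x \<in> L" using p[of x "\<zero>\<^bsub>N\<^esub>"] x N'(4) by simp
    then show ?thesis using L(2) x by (auto simp: L0_def)
  qed
  have "ss_injective_wrt R M N'" using inj N'(1) by (simp add: strongly_ss_injective_def)
  from extend_along_surjection[OF N N'(1) M N'(2,3) small ss f ker this]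
  show "\<exists>g \<in> rmod_hom R N M. \<forall>x\<in>K. g x = f x" by blast
qed

text \<open>
  Likewise, every simple right \<open>R\<close>-module has an isomorphic copy on the type \<open>'a set\<close>
  (the fibres of \<open>r \<mapsto> x r\<close> for some \<open>x \<noteq> 0\<close>), so a statement about all simple modules
  may be restricted to this type.
\<close>

theorem all_simple_strongly_ss_injective_all_types:
  fixes R :: "('a, 'c) ring_scheme" and M :: "('a, 'b) rmodule"
  assumes all: "\<forall>S :: ('a, 'a set) rmodule.
      right_module R S \<longrightarrow> simple_rmodule R S \<longrightarrow> strongly_ss_injective R S"
    and M: "right_module R M" and simple: "simple_rmodule R M"
  shows "strongly_ss_injective R M"
proof -
  interpret M: right_module R M by fact
  obtain x where x: "x \<in> carrier M" "x \<noteq> \<zero>\<^bsub>M\<^esub>"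
    using simple M.zero_closed unfolding simple_rmodule_def by (metis subsetI subset_singletonD empty_iff insert_iff)
  have "x \<in> (\<lambda>r. x \<triangleleft>\<^bsub>M\<^esub> r) ` carrier R"
    using x(1) by (intro image_eqI[of _ _ "\<one>\<^bsub>R\<^esub>"]) auto
  then have "(\<lambda>r. x \<triangleleft>\<^bsub>M\<^esub> r) ` carrier R \<noteq> {\<zero>\<^bsub>M\<^esub>}" using x(2) by blast
  then have cyc: "(\<lambda>r. x \<triangleleft>\<^bsub>M\<^esub> r) ` carrier R = carrier M"
    using simple M.rsubmodule_cyclic[OF x(1)] unfolding simple_rmodule_def by metis
  define p where "p y = {r \<in> carrier R. x \<triangleleft>\<^bsub>M\<^esub> r = y}" for y
  have p_inj: "p y = p z \<longleftrightarrow> y = z" if "y \<in> carrier M" "z \<in> carrier M" for y z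
  proof
    assume eq: "p y = p z"
    have "y \<in> (\<lambda>r. x \<triangleleft>\<^bsub>M\<^esub> r) ` carrier R" using that(1) by (simp add: cyc)
    then obtain r where "r \<in> carrier R" "x \<triangleleft>\<^bsub>M\<^esub> r = y" by blast
    then have "r \<in> p y" by (simp add: p_def)
    then have "r \<in> p z" using eq by simp
    then show "y = z" using \<open>x \<triangleleft>\<^bsub>M\<^esub> r = y\<close> by (simp add: p_def)
  qed simp
  have zero: "rsubmodule R M {\<zero>\<^bsub>M\<^esub>}" by (simp add: M.rsubmodule_iff)
  have p: "p y = p z \<longleftrightarrow> y \<ominus>\<^bsub>M\<^esub> z \<in> {\<zero>\<^bsub>M\<^esub>}" if "y \<in> carrier M" "z \<in> carrier M" for y z
    using that p_inj[OF that] M.diff_add_cancel[OF that] by (auto simp: a_minus_def M.r_neg)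
  obtain S :: "('a, 'a set) rmodule" where S: "right_module R S" "p \<in> rmod_hom R M S"
    "p ` carrier M = carrier S" "p \<zero>\<^bsub>M\<^esub> = \<zero>\<^bsub>S\<^esub>"
    using fibres_cosets_module[OF M zero p] by blast
  interpret S: right_module R S by fact
  have "p x \<in> carrier S" "p x \<noteq> \<zero>\<^bsub>S\<^esub>"
    using p_inj[of x "\<zero>\<^bsub>M\<^esub>"] x S(4) rmod_homD(1)[OF S(2)] by auto
  then have "carrier S \<noteq> {\<zero>\<^bsub>S\<^esub>}" by blast
  then have "simple_rmodule R S" using simple_image[OF M S(1,2,3) simple] by blast
  then have Sinj: "strongly_ss_injective R S" using all S(1) by blast
  note pD = rmod_homD[OF S(2)]
  define q where "q u = (THE y. y \<in> carrier M \<and> p y = u)" for u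
  have qp: "q (p y) = y" if "y \<in> carrier M" for y
    unfolding q_def using that p_inj by (intro the_equality) auto
  have q: "q \<in> rmod_hom R S M"
    unfolding rmod_hom_def S(3)[symmetric] by (auto simp: qp pD(2,3)[symmetric])
  note qD = rmod_homD[OF q]
  show ?thesis
    unfolding strongly_ss_injective_def ss_injective_wrt_def hom_extends_def
  proof (intro allI impI ballI, elim conjE)
    fix N :: "('a, 'a \<Rightarrow> 'b) rmodule" and K f
    assume N: "right_module R N"
      and K: "small_submodule R N K" "semisimple_rmodule R (N\<lparr>carrier := K\<rparr>)"
      and f: "f \<in> rmod_hom R (N\<lparr>carrier := K\<rparr>) M"
    note fD = rmod_homD[OF f]
    have "p \<circ> f \<in> rmod_hom R (N\<lparr>carrier := K\<rparr>) S"
      using fD pD by (auto simp: rmod_hom_def)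
    moreover have "hom_extends R S N K"
      using strongly_ss_injective_all_types[OF S(1) Sinj N] K by (simp add: ss_injective_wrt_def)
    ultimately obtain g where g: "g \<in> rmod_hom R N S" "\<And>y. y \<in> K \<Longrightarrow> g y = p (f y)"
      by (auto simp: hom_extends_def)
    have "q \<circ> g \<in> rmod_hom R N M"
      using rmod_homD[OF g(1)] qD by (auto simp: rmod_hom_def)
    moreover have "(q \<circ> g) y = f y" if "y \<in> K" for y
      using that g(2) qp fD(1) by simp
    ultimately show "\<exists>g\<in>rmod_hom R N M. \<forall>x\<in>K. g x = f x" by blast
  qed
qed

end

theory Submission
  imports Defs
begin

text \<open>
  Let \<open>M\<close> be semisimple and strongly ss-injective, let \<open>K\<close> be small in \<open>N\<close> and let
  \<open>f\<close> be a homomorphism from \<open>K\<close> to \<open>M\<close> with kernel \<open>L\<close>.  In \<open>N / L\<close> the image \<open>K / L\<close> of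
  \<open>K\<close> is still small, and it is isomorphic to the submodule \<open>f K\<close> of \<open>M\<close>, hence semisimple
  (\<open>semisimple_submodule\<close>).  So the map induced by \<open>f\<close> extends from \<open>K / L\<close> to \<open>N / L\<close>, and
  composing with the projection of \<open>N\<close> onto \<open>N / L\<close> extends \<open>f\<close>
  (\<open>semisimple_target_extends_from_small\<close>).  Small injectivity is the case \<open>N = R\<close>.

  For semiprimitivity let \<open>x \<noteq> 0\<close> lie in the Jacobson radical \<open>J\<close>.  The cyclic module
  \<open>x R\<close> has a maximal submodule \<open>L\<close>, so \<open>S = x R / L\<close> is simple, hence by hypothesis strongly
  ss-injective, hence small injective.  As \<open>x R\<close> is contained in \<open>J\<close>, it is small
  (\<open>small_if_in_jacobson_radical\<close>), and the projection from \<open>x R\<close> to \<open>S\<close> extends to a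
  homomorphism \<open>g\<close> on \<open>R\<close>, which is \<open>r \<mapsto> g(1) r\<close>.  But \<open>J\<close> annihilates every simple module
  (\<open>jacobson_radical_annihilates_simple\<close>), so \<open>g x = 0\<close>, whereas \<open>x\<close> is not in \<open>L\<close>.
\<close>

section \<open>Quotients and factorizations\<close>

lemma quotient_module:
  fixes N :: "('a, 'd) rmodule"
  assumes N: "right_module R N" and L: "rsubmodule R N L"
  obtains N' :: "('a, 'd set) rmodule" and h where "right_module R N'" "h \<in> rmod_hom R N N'"
    "h ` carrier N = carrier N'" "\<forall>x\<in>carrier N. h x = \<zero>\<^bsub>N'\<^esub> \<longleftrightarrow> x \<in> L"
proof -
  interpret N: right_module R N by fact
  define h where "h x = {y \<in> carrier N. y \<ominus>\<^bsub>N\<^esub> x \<in> L}" for x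
  have h: "h x = h y \<longleftrightarrow> x \<ominus>\<^bsub>N\<^esub> y \<in> L" if x: "x \<in> carrier N" and y: "y \<in> carrier N" for x y
  proof
    have "x \<ominus>\<^bsub>N\<^esub> x \<in> L" using x L by (simp add: N.rsubmodule_iff a_minus_def N.r_neg)
    then have "x \<in> h x" using x by (simp add: h_def)
    moreover assume "h x = h y"
    ultimately have "x \<in> h y" by simp
    then show "x \<ominus>\<^bsub>N\<^esub> y \<in> L" by (simp add: h_def)
  next
    assume d: "x \<ominus>\<^bsub>N\<^esub> y \<in> L"
    have "z \<ominus>\<^bsub>N\<^esub> x \<in> L \<longleftrightarrow> z \<ominus>\<^bsub>N\<^esub> y \<in> L" if z: "z \<in> carrier N" for z
    proof
      assume "z \<ominus>\<^bsub>N\<^esub> x \<in> L"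
      then show "z \<ominus>\<^bsub>N\<^esub> y \<in> L" using d N.diff_add_diff[OF z x y] L by (metis N.rsubmodule_iff)
    next
      assume "z \<ominus>\<^bsub>N\<^esub> y \<in> L"
      then have "(z \<ominus>\<^bsub>N\<^esub> y) \<ominus>\<^bsub>N\<^esub> (x \<ominus>\<^bsub>N\<^esub> y) \<in> L" using d N.rsubmodule_diff[OF L] by blast
      then show "z \<ominus>\<^bsub>N\<^esub> x \<in> L" using x y z by (simp add: N.diff_diff_cancel)
    qed
    then show "h x = h y" by (auto simp: h_def)
  qed
  obtain N' :: "('a, 'd set) rmodule" where N': "right_module R N'" "h \<in> rmod_hom R N N'"
    "h ` carrier N = carrier N'" "h \<zero>\<^bsub>N\<^esub> = \<zero>\<^bsub>N'\<^esub>"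
    by (rule fibres_cosets_module[OF N L h])
  have "\<forall>x\<in>carrier N. h x = \<zero>\<^bsub>N'\<^esub> \<longleftrightarrow> x \<in> L"
    using h[OF _ N.zero_closed] N'(4) by simp
  with N'(1-3) show ?thesis by (rule that)
qed

lemma rmod_hom_factor:
  assumes N: "right_module R N" and N': "right_module R N'" and M: "right_module R M"
    and h: "h \<in> rmod_hom R N N'" and onto: "h ` carrier N = carrier N'"
    and f: "f \<in> rmod_hom R N M"
    and ker: "\<And>x. x \<in> carrier N \<Longrightarrow> h x = \<zero>\<^bsub>N'\<^esub> \<Longrightarrow> f x = \<zero>\<^bsub>M\<^esub>"
  obtains k where "k \<in> rmod_hom R N' M" "\<forall>x\<in>carrier N. k (h x) = f x"
proof -
  interpret N: right_module R N by fact
  interpret N': right_module R N' by fact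
  interpret M: right_module R M by fact
  note hD = rmod_homD[OF h] and fD = rmod_homD[OF f]
  have eq: "f x = f y" if x: "x \<in> carrier N" and y: "y \<in> carrier N" and "h x = h y" for x y
  proof -
    have "h (x \<ominus>\<^bsub>N\<^esub> y) = \<zero>\<^bsub>N'\<^esub>"
      using rmod_hom_diff[OF N N' h x y] that hD(1)[OF y] by (simp add: a_minus_def N'.r_neg)
    then have "f (x \<ominus>\<^bsub>N\<^esub> y) = \<zero>\<^bsub>M\<^esub>" using ker x y by (simp add: N.minus_closed)
    then have "f x \<ominus>\<^bsub>M\<^esub> f y = \<zero>\<^bsub>M\<^esub>" using rmod_hom_diff[OF N M f x y] by simp
    then show ?thesis using M.diff_add_cancel[OF fD(1)[OF x] fD(1)[OF y]] fD(1)[OF y] by simp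
  qed
  define k where "k u = f (SOME x. x \<in> carrier N \<and> h x = u)" for u
  have k: "k (h x) = f x" if "x \<in> carrier N" for x
    unfolding k_def using eq that by (metis (mono_tags, lifting) someI_ex)
  have "k \<in> rmod_hom R N' M"
    unfolding rmod_hom_def onto[symmetric]
    by (auto simp: k fD hD(2,3)[symmetric])
  moreover have "\<forall>x\<in>carrier N. k (h x) = f x" using k by blast
  ultimately show ?thesis by (rule that)
qed


section \<open>Submodules of semisimple modules\<close>

lemma simple_imp_semisimple:
  assumes "right_module R M" "simple_rmodule R M"
  shows "semisimple_rmodule R M"
proof -
  interpret right_module R M by fact
  have "M\<lparr>carrier := carrier M\<rparr> = M" by simp
  then have "carrier M \<subseteq> socle R M"
    using assms(2) rsubmodule_carrier unfolding socle_def by auto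
  moreover have "\<And>S. rsubmodule R M S \<Longrightarrow> S \<subseteq> carrier M" by (simp add: rsubmodule_iff)
  then have "socle R M \<subseteq> carrier M" unfolding socle_def using rsubmodule_carrier by blast
  ultimately show ?thesis by (simp add: semisimple_rmodule_def)
qed

text \<open>
  A submodule \<open>L\<close> maximal with \<open>L \<inter> A = 0\<close> is a complement: a simple \<open>S\<close> not inside \<open>L\<close> meets
  \<open>A + L\<close> in a nonzero element by maximality, so \<open>S \<subseteq> A + L\<close>; and the simple submodules
  generate \<open>M\<close>.
\<close>

lemma semisimple_complement:
  assumes M: "right_module R M" and ss: "semisimple_rmodule R M" and A: "rsubmodule R M A"
  obtains L where "rsubmodule R M L" "L \<inter> A = {\<zero>\<^bsub>M\<^esub>}" "A <+>\<^bsub>M\<^esub> L = carrier M"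
proof -
  interpret M: right_module R M by fact
  have Z: "rsubmodule R M {\<zero>\<^bsub>M\<^esub>}" "{\<zero>\<^bsub>M\<^esub>} \<subseteq> A" using A by (auto simp: M.rsubmodule_iff)
  obtain L where L: "rsubmodule R M L" "L \<inter> A = {\<zero>\<^bsub>M\<^esub>}"
    and ess: "\<And>x. x \<in> carrier M \<Longrightarrow> x \<notin> L \<Longrightarrow>
      \<exists>r\<in>carrier R. \<exists>y\<in>A - {\<zero>\<^bsub>M\<^esub>}. x \<triangleleft>\<^bsub>M\<^esub> r \<ominus>\<^bsub>M\<^esub> y \<in> L"
    using relative_complement[OF M A Z] by blast
  have D: "rsubmodule R M (A <+>\<^bsub>M\<^esub> L)" using M.rsubmodule_sum[OF A L(1)] .
  have mem: "A \<subseteq> carrier M" "\<zero>\<^bsub>M\<^esub> \<in> A" "L \<subseteq> carrier M"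
    using A L(1) by (auto simp: M.rsubmodule_iff)
  have "S \<subseteq> A <+>\<^bsub>M\<^esub> L"
    if S: "rsubmodule R M S" and simple: "simple_rmodule R (M\<lparr>carrier := S\<rparr>)" for S
  proof (cases "S \<subseteq> L")
    case True
    have "l \<in> A <+>\<^bsub>M\<^esub> L" if "l \<in> L" for l
    proof -
      have "l = \<zero>\<^bsub>M\<^esub> \<oplus>\<^bsub>M\<^esub> l" using that mem by auto
      then show ?thesis using that mem(2) unfolding set_add_def' by blast
    qed
    then show ?thesis using True by blast
  next
    case False
    then obtain x where x: "x \<in> S" "x \<notin> L" by blast
    have xM: "x \<in> carrier M" using x S by (auto simp: M.rsubmodule_iff)
    obtain r y where ry: "r \<in> carrier R" "y \<in> A" "y \<noteq> \<zero>\<^bsub>M\<^esub>" "x \<triangleleft>\<^bsub>M\<^esub> r \<ominus>\<^bsub>M\<^esub> y \<in> L"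
      using ess[OF xM x(2)] by auto
    have yM: "y \<in> carrier M" using ry mem by auto
    have sum: "x \<triangleleft>\<^bsub>M\<^esub> r = y \<oplus>\<^bsub>M\<^esub> (x \<triangleleft>\<^bsub>M\<^esub> r \<ominus>\<^bsub>M\<^esub> y)"
      using M.diff_add_cancel[of "x \<triangleleft>\<^bsub>M\<^esub> r" y] xM yM ry(1)
      by (simp add: M.a_comm M.minus_closed)
    then have inD: "x \<triangleleft>\<^bsub>M\<^esub> r \<in> A <+>\<^bsub>M\<^esub> L" using ry unfolding set_add_def' by blast
    have inS: "x \<triangleleft>\<^bsub>M\<^esub> r \<in> S" using S x ry by (auto simp: M.rsubmodule_iff)
    have "x \<triangleleft>\<^bsub>M\<^esub> r \<noteq> \<zero>\<^bsub>M\<^esub>"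
    proof
      assume "x \<triangleleft>\<^bsub>M\<^esub> r = \<zero>\<^bsub>M\<^esub>"
      then have "\<zero>\<^bsub>M\<^esub> \<ominus>\<^bsub>M\<^esub> (\<zero>\<^bsub>M\<^esub> \<ominus>\<^bsub>M\<^esub> y) \<in> L"
        using M.rsubmodule_diff[OF L(1) _ ry(4)] L(2) by auto
      then have "y \<in> L" using yM by (simp add: M.neg_diff M.minus_eq)
      then show False using L(2) ry by blast
    qed
    moreover have "rsubmodule R M (S \<inter> (A <+>\<^bsub>M\<^esub> L))"
      using S D by (auto simp: M.rsubmodule_iff)
    then have "S \<inter> (A <+>\<^bsub>M\<^esub> L) = {\<zero>\<^bsub>M\<^esub>} \<or> S \<inter> (A <+>\<^bsub>M\<^esub> L) = S"
      using simple unfolding simple_rmodule_def M.rsubmodule_of_submodule[OF S] by auto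
    ultimately show ?thesis using inD inS by blast
  qed
  then have "socle R M \<subseteq> A <+>\<^bsub>M\<^esub> L" using D unfolding socle_def by blast
  then have "A <+>\<^bsub>M\<^esub> L = carrier M"
    using ss D by (auto simp: semisimple_rmodule_def M.rsubmodule_iff)
  then show ?thesis using that L by blast
qed

text \<open>Projecting along a complement makes the submodule a homomorphic image of \<open>M\<close>.\<close>

lemma semisimple_submodule:
  assumes M: "right_module R M" and ss: "semisimple_rmodule R M" and A: "rsubmodule R M A"
  shows "semisimple_rmodule R (M\<lparr>carrier := A\<rparr>)"
proof -
  interpret M: right_module R M by fact
  obtain L where L: "rsubmodule R M L" "L \<inter> A = {\<zero>\<^bsub>M\<^esub>}" and sum: "A <+>\<^bsub>M\<^esub> L = carrier M"
    using semisimple_complement[OF assms] by blast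
  have AD: "A \<subseteq> carrier M" "\<And>x y. x \<in> A \<Longrightarrow> y \<in> A \<Longrightarrow> x \<oplus>\<^bsub>M\<^esub> y \<in> A"
    "\<And>x r. x \<in> A \<Longrightarrow> r \<in> carrier R \<Longrightarrow> x \<triangleleft>\<^bsub>M\<^esub> r \<in> A"
    using A by (auto simp: M.rsubmodule_iff)
  have LD: "L \<subseteq> carrier M" "\<zero>\<^bsub>M\<^esub> \<in> L" "\<And>x y. x \<in> L \<Longrightarrow> y \<in> L \<Longrightarrow> x \<oplus>\<^bsub>M\<^esub> y \<in> L"
    "\<And>x r. x \<in> L \<Longrightarrow> r \<in> carrier R \<Longrightarrow> x \<triangleleft>\<^bsub>M\<^esub> r \<in> L"
    using L by (auto simp: M.rsubmodule_iff)
  define q where "q z = (SOME a. a \<in> A \<and> z \<ominus>\<^bsub>M\<^esub> a \<in> L)" for z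
  have q: "q z \<in> A \<and> z \<ominus>\<^bsub>M\<^esub> q z \<in> L" if z: "z \<in> carrier M" for z
  proof -
    obtain a l where al: "a \<in> A" "l \<in> L" "z = a \<oplus>\<^bsub>M\<^esub> l"
      using z unfolding sum[symmetric] by (auto simp: set_add_def')
    then have "z \<ominus>\<^bsub>M\<^esub> a = l" using AD(1) LD(1) M.add_diff_cancel by blast
    then have "\<exists>a. a \<in> A \<and> z \<ominus>\<^bsub>M\<^esub> a \<in> L" using al by blast
    from someI_ex[OF this] show ?thesis by (simp add: q_def)
  qed
  have q_eq: "q z = a" if z: "z \<in> carrier M" and a: "a \<in> A" "z \<ominus>\<^bsub>M\<^esub> a \<in> L" for z a
  proof -
    have c: "q z \<in> carrier M" "a \<in> carrier M" using q[OF z] a AD(1) by auto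
    have "(z \<ominus>\<^bsub>M\<^esub> a) \<ominus>\<^bsub>M\<^esub> (z \<ominus>\<^bsub>M\<^esub> q z) \<in> L"
      using M.rsubmodule_diff[OF L(1)] a q[OF z] by blast
    also have "(z \<ominus>\<^bsub>M\<^esub> a) \<ominus>\<^bsub>M\<^esub> (z \<ominus>\<^bsub>M\<^esub> q z) = (z \<ominus>\<^bsub>M\<^esub> z) \<ominus>\<^bsub>M\<^esub> (a \<ominus>\<^bsub>M\<^esub> q z)"
      using z c by (intro M.diff_diff_swap)
    also have "\<dots> = \<ominus>\<^bsub>M\<^esub> (a \<ominus>\<^bsub>M\<^esub> q z)"
      using z c M.minus_closed[OF c(2,1)] by (simp add: M.minus_eq[of z z] M.minus_eq[of "\<zero>\<^bsub>M\<^esub>"] M.r_neg)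
    also have "\<dots> = q z \<ominus>\<^bsub>M\<^esub> a" using M.neg_diff[OF c(2,1)] .
    finally have "q z \<ominus>\<^bsub>M\<^esub> a \<in> L" .
    moreover have "q z \<ominus>\<^bsub>M\<^esub> a \<in> A" using M.rsubmodule_diff[OF A] q[OF z] a by blast
    ultimately have "q z \<ominus>\<^bsub>M\<^esub> a = \<zero>\<^bsub>M\<^esub>" using L(2) by blast
    then show ?thesis using M.diff_add_cancel[OF c] c by simp
  qed
  have "q (x \<oplus>\<^bsub>M\<^esub> y) = q x \<oplus>\<^bsub>M\<^esub> q y" if x: "x \<in> carrier M" and y: "y \<in> carrier M" for x y
  proof (rule q_eq)
    have c: "q x \<in> carrier M" "q y \<in> carrier M" using q x y AD(1) by auto
    have "(x \<ominus>\<^bsub>M\<^esub> q x) \<oplus>\<^bsub>M\<^esub> (y \<ominus>\<^bsub>M\<^esub> q y) \<in> L" using LD(3) q x y by blast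
    also have "(x \<ominus>\<^bsub>M\<^esub> q x) \<oplus>\<^bsub>M\<^esub> (y \<ominus>\<^bsub>M\<^esub> q y) = (x \<oplus>\<^bsub>M\<^esub> y) \<ominus>\<^bsub>M\<^esub> (q x \<oplus>\<^bsub>M\<^esub> q y)"
      using c x y by (simp add: a_minus_def M.a_ac M.minus_add)
    finally show "(x \<oplus>\<^bsub>M\<^esub> y) \<ominus>\<^bsub>M\<^esub> (q x \<oplus>\<^bsub>M\<^esub> q y) \<in> L" .
  qed (use x y q AD in auto)
  moreover have "q (x \<triangleleft>\<^bsub>M\<^esub> r) = q x \<triangleleft>\<^bsub>M\<^esub> r" if x: "x \<in> carrier M" and r: "r \<in> carrier R" for x r
  proof (rule q_eq)
    have "q x \<in> carrier M" using q x AD(1) by auto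
    then show "x \<triangleleft>\<^bsub>M\<^esub> r \<ominus>\<^bsub>M\<^esub> q x \<triangleleft>\<^bsub>M\<^esub> r \<in> L"
      using LD(4)[of "x \<ominus>\<^bsub>M\<^esub> q x" r] q x r by (simp add: M.rsmult_diff)
  qed (use x r q AD in auto)
  ultimately have hom: "q \<in> rmod_hom R M (M\<lparr>carrier := A\<rparr>)"
    using q by (auto simp: rmod_hom_def)
  have "a \<in> q ` carrier M" if "a \<in> A" for a
  proof -
    have "a \<in> carrier M" using that AD(1) by blast
    moreover from this have "q a = a" using that LD(2) by (intro q_eq) (auto simp: a_minus_def M.r_neg)
    ultimately show ?thesis by (metis imageI)
  qed
  then have "q ` carrier M = carrier (M\<lparr>carrier := A\<rparr>)" using q by auto
  from semisimple_image[OF M M.submodule_is_right_module[OF A] hom this ss] show ?thesis .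
qed


section \<open>Extension from small submodules\<close>

text \<open>
  Passing to \<open>N / ker f\<close> replaces \<open>K\<close> by an isomorphic copy of \<open>f K\<close>, which is semisimple
  whether or not \<open>K\<close> is.
\<close>

lemma semisimple_target_extends_from_small:
  fixes M :: "('a, 'b) rmodule" and N :: "('a, 'd) rmodule"
  assumes M: "right_module R M" and ss: "semisimple_rmodule R M"
    and inj: "strongly_ss_injective R M"
    and N: "right_module R N" and small: "small_submodule R N K"
  shows "hom_extends R M N K"
  unfolding hom_extends_def
proof
  interpret M: right_module R M by fact
  interpret N: right_module R N by fact
  fix f assume f: "f \<in> rmod_hom R (N\<lparr>carrier := K\<rparr>) M"
  have K: "rsubmodule R N K" using small by (simp add: small_submodule_def)
  then have Kc: "K \<subseteq> carrier N" by (simp add: N.rsubmodule_iff)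
  note NK = N.submodule_is_right_module[OF K]
  interpret NK: right_module R "N\<lparr>carrier := K\<rparr>" by (rule NK)
  define L where "L = {x \<in> K. f x = \<zero>\<^bsub>M\<^esub>}"
  have "rsubmodule R M {\<zero>\<^bsub>M\<^esub>}" by (simp add: M.rsubmodule_iff)
  from rsubmodule_preimage[OF NK M f this]
  have L: "rsubmodule R N L" by (simp add: L_def N.rsubmodule_of_submodule[OF K])
  obtain N' :: "('a, 'd set) rmodule" and h where N': "right_module R N'"
    and h: "h \<in> rmod_hom R N N'" and onto: "h ` carrier N = carrier N'"
    and ker: "\<forall>x\<in>carrier N. h x = \<zero>\<^bsub>N'\<^esub> \<longleftrightarrow> x \<in> L"
    by (rule quotient_module[OF N L])
  interpret N': right_module R N' by fact
  have ker_eq: "h x = \<zero>\<^bsub>N'\<^esub> \<longleftrightarrow> f x = \<zero>\<^bsub>M\<^esub>" if "x \<in> K" for x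
    using ker that Kc by (auto simp: L_def)
  have hK: "h \<in> rmod_hom R (N\<lparr>carrier := K\<rparr>) (N'\<lparr>carrier := h ` K\<rparr>)"
    using rmod_hom_restrict[OF h Kc] by blast
  have fK: "f \<in> rmod_hom R (N\<lparr>carrier := K\<rparr>) (M\<lparr>carrier := f ` K\<rparr>)"
    using rmod_hom_restrict[OF f, of K "f ` K"] by simp
  have im_h: "rsubmodule R N' (h ` K)" using rsubmodule_image[OF N N' h K] .
  have im_f: "rsubmodule R M (f ` K)"
    using rsubmodule_image[OF NK M f NK.rsubmodule_carrier] by simp
  note N'K = N'.submodule_is_right_module[OF im_h] and MK = M.submodule_is_right_module[OF im_f]
  obtain k where k: "k \<in> rmod_hom R (M\<lparr>carrier := f ` K\<rparr>) (N'\<lparr>carrier := h ` K\<rparr>)"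
    "\<forall>x\<in>carrier (N\<lparr>carrier := K\<rparr>). k (f x) = h x"
    by (rule rmod_hom_factor[OF NK MK N'K fK _ hK]) (use ker_eq in auto)
  have "k ` (f ` K) = h ` K" using k(2) by (simp add: image_image)
  then have "semisimple_rmodule R (N'\<lparr>carrier := h ` K\<rparr>)"
    using semisimple_image[OF MK N'K k(1) _ semisimple_submodule[OF M ss im_f]] by simp
  moreover have "small_submodule R N' (h ` K)"
    using small_submodule_image[OF N N' h onto small] .
  ultimately have ext: "hom_extends R M N' (h ` K)"
    using strongly_ss_injective_all_types[OF M inj N'] by (simp add: ss_injective_wrt_def)
  obtain f' where f': "f' \<in> rmod_hom R (N'\<lparr>carrier := h ` K\<rparr>) M"
    "\<forall>x\<in>carrier (N\<lparr>carrier := K\<rparr>). f' (h x) = f x"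
    by (rule rmod_hom_factor[OF NK N'K M hK _ f]) (use ker_eq in auto)
  obtain g where g: "g \<in> rmod_hom R N' M" "\<And>x. x \<in> K \<Longrightarrow> g (h x) = f x"
    using ext f' by (auto simp: hom_extends_def)
  have "g \<circ> h \<in> rmod_hom R N M"
    using rmod_homD[OF g(1)] rmod_homD[OF h] by (auto simp: rmod_hom_def)
  then show "\<exists>g \<in> rmod_hom R N M. \<forall>x\<in>K. g x = f x" using g(2) by (metis comp_apply)
qed


section \<open>The Jacobson radical\<close>

lemma right_regular_simps [simp]:
  "carrier (right_regular R) = carrier R" "\<zero>\<^bsub>right_regular R\<^esub> = \<zero>\<^bsub>R\<^esub>"
  "x \<oplus>\<^bsub>right_regular R\<^esub> y = x \<oplus>\<^bsub>R\<^esub> y" "x \<triangleleft>\<^bsub>right_regular R\<^esub> r = x \<otimes>\<^bsub>R\<^esub> r"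
  by (simp_all add: right_regular_def)

lemma right_module_right_regular:
  assumes "ring R"
  shows "right_module R (right_regular R)"
proof -
  interpret ring R by fact
  have "abelian_group (right_regular R)"
    by (rule abelian_groupI) (auto simp: a_ac intro: l_neg bexI[of _ "\<ominus>\<^bsub>R\<^esub> x" for x])
  moreover have "right_module_axioms R (right_regular R)"
    by unfold_locales (auto simp: l_distr r_distr m_assoc)
  ultimately show ?thesis by (intro right_module.intro assms)
qed

lemma right_ideal_eq_carrier:
  assumes "ring R" "right_ideal R I" "\<one>\<^bsub>R\<^esub> \<in> I"
  shows "I = carrier R"
proof -
  interpret ring R by fact
  interpret N: right_module R "right_regular R" by (rule right_module_right_regular) fact
  have "r \<in> I" if "r \<in> carrier R" for r
    using assms(2,3) that l_one[OF that] unfolding N.rsubmodule_iff by (metis right_regular_simps(4))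
  then show ?thesis using assms(2) by (auto simp: N.rsubmodule_iff)
qed

corollary strongly_ss_injective_imp_small_injective:
  assumes M: "right_module R M" and "semisimple_rmodule R M" "strongly_ss_injective R M"
  shows "small_injective R M"
proof -
  interpret M: right_module R M by fact
  show ?thesis
    using semisimple_target_extends_from_small[OF assms right_module_right_regular]
      M.R.ring_axioms by (auto simp: small_injective_def)
qed

text \<open>
  When \<open>x\<close> generates \<open>N\<close>, the submodules avoiding \<open>x\<close> are the proper ones, so this yields
  maximal submodules of cyclic modules, in particular maximal right ideals.
\<close>

lemma maximal_submodule_avoiding:
  assumes N: "right_module R N" and A: "rsubmodule R N A" "x \<notin> A"
  obtains L where "rsubmodule R N L" "A \<subseteq> L" "x \<notin> L"
    "\<forall>X. rsubmodule R N X \<longrightarrow> x \<notin> X \<longrightarrow> L \<subseteq> X \<longrightarrow> X = L"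
proof -
  interpret N: right_module R N by fact
  define F where "F = {L. rsubmodule R N L \<and> A \<subseteq> L \<and> x \<notin> L}"
  have "\<exists>L\<in>F. \<forall>X\<in>F. L \<subseteq> X \<longrightarrow> X = L"
  proof (rule subset_Zorn_nonempty)
    show "F \<noteq> {}" using A by (auto simp: F_def)
    fix C assume ne: "C \<noteq> {}" and chain: "subset.chain F C"
    have CF: "\<And>L. L \<in> C \<Longrightarrow> rsubmodule R N L \<and> A \<subseteq> L \<and> x \<notin> L"
      and lin: "\<And>X Y. X \<in> C \<Longrightarrow> Y \<in> C \<Longrightarrow> X \<subseteq> Y \<or> Y \<subseteq> X"
      using chain unfolding subset.chain_def F_def by blast+
    have "y \<oplus>\<^bsub>N\<^esub> z \<in> \<Union>C" if yz: "y \<in> \<Union>C" "z \<in> \<Union>C" for y z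
    proof -
      obtain X Y where "X \<in> C" "y \<in> X" "Y \<in> C" "z \<in> Y" using yz by blast
      then obtain Z where "Z \<in> C" "y \<in> Z" "z \<in> Z" using lin[of X Y] by blast
      then show ?thesis using CF[of Z] by (auto simp: N.rsubmodule_iff)
    qed
    moreover have "\<Union>C \<subseteq> carrier N" "\<zero>\<^bsub>N\<^esub> \<in> \<Union>C"
      using CF ne unfolding N.rsubmodule_iff by blast+
    moreover have "y \<triangleleft>\<^bsub>N\<^esub> r \<in> \<Union>C" if "y \<in> \<Union>C" "r \<in> carrier R" for y r
      using that CF unfolding N.rsubmodule_iff by blast
    ultimately have "rsubmodule R N (\<Union>C)" by (simp add: N.rsubmodule_iff)
    then show "\<Union>C \<in> F" using CF ne by (auto simp: F_def)
  qed
  then obtain L where L: "rsubmodule R N L" "A \<subseteq> L" "x \<notin> L"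
    and max: "\<forall>X\<in>F. L \<subseteq> X \<longrightarrow> X = L" by (auto simp: F_def)
  have "\<forall>X. rsubmodule R N X \<longrightarrow> x \<notin> X \<longrightarrow> L \<subseteq> X \<longrightarrow> X = L"
    using max L(2) by (auto simp: F_def)
  with L show ?thesis by (rule that)
qed

lemma maximal_right_ideal_above:
  assumes R: "ring R" and A: "right_ideal R A" "A \<noteq> carrier R"
  obtains I where "maximal_right_ideal R I" "A \<subseteq> I"
proof -
  interpret ring R by fact
  have "\<one>\<^bsub>R\<^esub> \<notin> A" using right_ideal_eq_carrier[OF R] A by blast
  then obtain L where L: "right_ideal R L" "A \<subseteq> L" "\<one>\<^bsub>R\<^esub> \<notin> L"
    "\<forall>X. right_ideal R X \<longrightarrow> \<one>\<^bsub>R\<^esub> \<notin> X \<longrightarrow> L \<subseteq> X \<longrightarrow> X = L"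
    using maximal_submodule_avoiding[OF right_module_right_regular[OF R] A(1)] by blast
  then have "maximal_right_ideal R L"
    unfolding maximal_right_ideal_def using right_ideal_eq_carrier[OF R] by blast
  then show ?thesis using that L(2) by blast
qed

text \<open>
  A proper right ideal lies in a maximal one, which also contains the radical; so adding a part of
  the radical to it keeps it proper.
\<close>

lemma small_if_in_jacobson_radical:
  assumes R: "ring R" and A: "right_ideal R A" "A \<subseteq> jacobson_radical R"
  shows "small_submodule R (right_regular R) A"
  unfolding small_submodule_def
proof (intro conjI allI impI A(1))
  interpret N: right_module R "right_regular R" by (rule right_module_right_regular) fact
  fix L assume "right_ideal R L \<and> L \<noteq> carrier (right_regular R)"
  then obtain I where I: "maximal_right_ideal R I" "L \<subseteq> I"
    using maximal_right_ideal_above[OF R] by auto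
  have "A \<subseteq> I" using A(2) I(1) by (auto simp: jacobson_radical_def)
  moreover have "right_ideal R I" using I(1) by (simp add: maximal_right_ideal_def)
  then have "\<And>a b. a \<in> I \<Longrightarrow> b \<in> I \<Longrightarrow> a \<oplus>\<^bsub>right_regular R\<^esub> b \<in> I"
    by (simp add: N.rsubmodule_iff)
  ultimately have "A <+>\<^bsub>right_regular R\<^esub> L \<subseteq> I"
    using I(2) unfolding set_add_def' by blast
  then show "A <+>\<^bsub>right_regular R\<^esub> L \<noteq> carrier (right_regular R)"
    using I(1) unfolding maximal_right_ideal_def N.rsubmodule_iff by auto
qed

lemma right_ideal_jacobson_radical:
  assumes R: "ring R"
  shows "right_ideal R (jacobson_radical R)"
proof -
  interpret N: right_module R "right_regular R" by (rule right_module_right_regular) fact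
  have "\<zero>\<^bsub>R\<^esub> \<in> I \<and> (\<forall>x\<in>I. \<forall>y\<in>I. x \<oplus>\<^bsub>R\<^esub> y \<in> I) \<and> (\<forall>x\<in>I. \<forall>r\<in>carrier R. x \<otimes>\<^bsub>R\<^esub> r \<in> I)"
    if "maximal_right_ideal R I" for I
    using that by (simp add: maximal_right_ideal_def N.rsubmodule_iff)
  then show ?thesis
    unfolding N.rsubmodule_iff jacobson_radical_def by auto
qed

text \<open>A nonzero element of a simple module has a maximal right ideal as annihilator.\<close>

lemma jacobson_radical_annihilates_simple:
  assumes S: "right_module R S" and simple: "simple_rmodule R S"
    and s: "s \<in> carrier S" and x: "x \<in> jacobson_radical R"
  shows "s \<triangleleft>\<^bsub>S\<^esub> x = \<zero>\<^bsub>S\<^esub>"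
proof (cases "s = \<zero>\<^bsub>S\<^esub>")
  case True
  interpret S: right_module R S by fact
  show ?thesis using True x by (simp add: jacobson_radical_def)
next
  case False
  interpret S: right_module R S by fact
  have R: "ring R" by (rule S.R.ring_axioms)
  note N = right_module_right_regular[OF R]
  interpret N: right_module R "right_regular R" by (rule N)
  define I where "I = {r \<in> carrier R. s \<triangleleft>\<^bsub>S\<^esub> r \<in> {\<zero>\<^bsub>S\<^esub>}}"
  have hom: "(\<lambda>r. s \<triangleleft>\<^bsub>S\<^esub> r) \<in> rmod_hom R (right_regular R) S"
    using s by (auto simp: rmod_hom_def S.rsmult_distr_scalar S.rsmult_assoc)
  have Z: "rsubmodule R S {\<zero>\<^bsub>S\<^esub>}" by (simp add: S.rsubmodule_iff)
  have I: "right_ideal R I"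
    using rsubmodule_preimage[OF N S hom Z] by (simp add: I_def)
  have "J = carrier R" if J: "right_ideal R J" "I \<subseteq> J" "J \<noteq> I" for J
  proof -
    have Jc: "J \<subseteq> carrier R" using J by (simp add: N.rsubmodule_iff)
    have "rsubmodule R S ((\<lambda>r. s \<triangleleft>\<^bsub>S\<^esub> r) ` J)" using rsubmodule_image[OF N S hom J(1)] .
    moreover have "(\<lambda>r. s \<triangleleft>\<^bsub>S\<^esub> r) ` J \<noteq> {\<zero>\<^bsub>S\<^esub>}" using J(2,3) Jc by (auto simp: I_def)
    ultimately have "(\<lambda>r. s \<triangleleft>\<^bsub>S\<^esub> r) ` J = carrier S" using simple by (auto simp: simple_rmodule_def)
    then have "s \<in> (\<lambda>r. s \<triangleleft>\<^bsub>S\<^esub> r) ` J" using s by simp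
    then obtain j where j: "j \<in> J" "s \<triangleleft>\<^bsub>S\<^esub> j = s" by auto
    have jc: "j \<in> carrier R" using j Jc by blast
    \<comment> \<open>As \<open>s j = s = s 1\<close>, the ideal \<open>J\<close> contains both \<open>j\<close> and \<open>1 - j\<close>.\<close>
    have "s \<triangleleft>\<^bsub>S\<^esub> (\<one>\<^bsub>R\<^esub> \<ominus>\<^bsub>right_regular R\<^esub> j) = s \<ominus>\<^bsub>S\<^esub> s"
      using rmod_hom_diff[OF N S hom, of "\<one>\<^bsub>R\<^esub>" j] j(2) jc s by simp
    then have "\<one>\<^bsub>R\<^esub> \<ominus>\<^bsub>right_regular R\<^esub> j \<in> I"
      using s jc N.minus_closed[of "\<one>\<^bsub>R\<^esub>" j] by (simp add: I_def a_minus_def[of S] S.r_neg)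
    then have "(\<one>\<^bsub>R\<^esub> \<ominus>\<^bsub>right_regular R\<^esub> j) \<oplus>\<^bsub>right_regular R\<^esub> j \<in> J"
      using J j unfolding N.rsubmodule_iff by blast
    then have "\<one>\<^bsub>R\<^esub> \<in> J" using N.diff_add_cancel[of "\<one>\<^bsub>R\<^esub>" j] jc by simp
    then show ?thesis using right_ideal_eq_carrier[OF R J(1)] by blast
  qed
  moreover have "\<one>\<^bsub>R\<^esub> \<notin> I" using False s by (simp add: I_def)
  ultimately have "maximal_right_ideal R I"
    using I unfolding maximal_right_ideal_def by auto
  then have "x \<in> I" using x by (simp add: jacobson_radical_def)
  then show ?thesis by (simp add: I_def)
qed

lemma cyclic_has_simple_quotient:
  fixes N :: "('a, 'd) rmodule"
  assumes N: "right_module R N" and x: "x \<in> carrier N" "x \<noteq> \<zero>\<^bsub>N\<^esub>"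
    and gen: "(\<lambda>r. x \<triangleleft>\<^bsub>N\<^esub> r) ` carrier R = carrier N"
  obtains S :: "('a, 'd set) rmodule" and h where "right_module R S" "simple_rmodule R S"
    "h \<in> rmod_hom R N S" "h x \<noteq> \<zero>\<^bsub>S\<^esub>"
proof -
  interpret N: right_module R N by fact
  have "rsubmodule R N {\<zero>\<^bsub>N\<^esub>}" "x \<notin> {\<zero>\<^bsub>N\<^esub>}" using x(2) by (simp_all add: N.rsubmodule_iff)
  then obtain L where L: "rsubmodule R N L" "{\<zero>\<^bsub>N\<^esub>} \<subseteq> L" "x \<notin> L"
    "\<forall>X. rsubmodule R N X \<longrightarrow> x \<notin> X \<longrightarrow> L \<subseteq> X \<longrightarrow> X = L"
    by (rule maximal_submodule_avoiding[OF N])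
  obtain S :: "('a, 'd set) rmodule" and h where S: "right_module R S"
    and h: "h \<in> rmod_hom R N S" and onto: "h ` carrier N = carrier S"
    and ker: "\<forall>y\<in>carrier N. h y = \<zero>\<^bsub>S\<^esub> \<longleftrightarrow> y \<in> L"
    by (rule quotient_module[OF N L(1)])
  interpret S: right_module R S by fact
  have hx: "h x \<noteq> \<zero>\<^bsub>S\<^esub>" using ker x(1) L(3) by simp
  have "B = {\<zero>\<^bsub>S\<^esub>} \<or> B = carrier S" if B: "rsubmodule R S B" for B
  proof -
    define X where "X = {y \<in> carrier N. h y \<in> B}"
    have X: "rsubmodule R N X" unfolding X_def using rsubmodule_preimage[OF N S h B] .
    have BD: "B \<subseteq> carrier S" "\<zero>\<^bsub>S\<^esub> \<in> B" using B by (auto simp: S.rsubmodule_iff)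
    have im: "h ` X = B" using BD(1) unfolding X_def onto[symmetric] by auto
    have Lc: "L \<subseteq> carrier N" using L(1) by (simp add: N.rsubmodule_iff)
    then have "y \<in> carrier N" "h y = \<zero>\<^bsub>S\<^esub>" if "y \<in> L" for y using ker that by auto
    then have LX: "L \<subseteq> X" using BD(2) by (auto simp: X_def)
    show ?thesis
    proof (cases "x \<in> X")
      case True
      then have "carrier N \<subseteq> X" using X unfolding gen[symmetric] by (auto simp: N.rsubmodule_iff)
      then have "X = carrier N" by (auto simp: X_def)
      then show ?thesis using im onto by simp
    next
      case False
      then have "X = L" using L(4) X LX by blast
      then have "B \<subseteq> {\<zero>\<^bsub>S\<^esub>}" using im ker Lc by auto
      then show ?thesis using BD(2) by blast
    qed
  qed
  moreover have "carrier S \<noteq> {\<zero>\<^bsub>S\<^esub>}" using hx rmod_homD(1)[OF h x(1)] by blast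
  ultimately have "simple_rmodule R S" by (simp add: simple_rmodule_def)
  from S this h hx show ?thesis by (rule that)
qed

lemma semiprimitive_if_simple_small_injective:
  fixes R :: "('a, 'c) ring_scheme"
  assumes R: "ring R"
    and inj: "\<And>S :: ('a, 'a set) rmodule.
      right_module R S \<Longrightarrow> simple_rmodule R S \<Longrightarrow> small_injective R S"
  shows "semiprimitive R"
proof -
  interpret ring R by fact
  note N = right_module_right_regular[OF R]
  interpret N: right_module R "right_regular R" by (rule N)
  have J: "right_ideal R (jacobson_radical R)" by (rule right_ideal_jacobson_radical[OF R])
  have "x = \<zero>\<^bsub>R\<^esub>" if x: "x \<in> jacobson_radical R" for x
  proof (rule ccontr)
    assume "x \<noteq> \<zero>\<^bsub>R\<^esub>"
    have xR: "x \<in> carrier R" using x by (simp add: jacobson_radical_def)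
    define A where "A = (\<lambda>r. x \<otimes>\<^bsub>R\<^esub> r) ` carrier R"
    have A: "right_ideal R A" using N.rsubmodule_cyclic[of x] xR by (simp add: A_def)
    have xA: "x \<in> A" unfolding A_def using xR by (intro image_eqI[of _ _ "\<one>\<^bsub>R\<^esub>"]) auto
    have "A \<subseteq> jacobson_radical R" using J x by (auto simp: A_def N.rsubmodule_iff)
    then have small: "small_submodule R (right_regular R) A"
      using small_if_in_jacobson_radical[OF R A] by blast
    obtain S :: "('a, 'a set) rmodule" and h where S: "right_module R S" "simple_rmodule R S"
      and h: "h \<in> rmod_hom R ((right_regular R)\<lparr>carrier := A\<rparr>) S" "h x \<noteq> \<zero>\<^bsub>S\<^esub>"
      using cyclic_has_simple_quotient[OF N.submodule_is_right_module[OF A], of x]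
        xA \<open>x \<noteq> \<zero>\<^bsub>R\<^esub>\<close> by (auto simp: A_def)
    have "hom_extends R S (right_regular R) A"
      using inj[OF S] small by (simp add: small_injective_def)
    then obtain g where g: "g \<in> rmod_hom R (right_regular R) S" "g x = h x"
      using h(1) xA by (auto simp: hom_extends_def)
    have "g x = g \<one>\<^bsub>R\<^esub> \<triangleleft>\<^bsub>S\<^esub> x" using rmod_homD(3)[OF g(1), of "\<one>\<^bsub>R\<^esub>" x] xR by simp
    also have "\<dots> = \<zero>\<^bsub>S\<^esub>"
      using jacobson_radical_annihilates_simple[OF S _ x] rmod_homD(1)[OF g(1)] by simp
    finally show False using g(2) h(2) by simp
  qed
  moreover have "\<zero>\<^bsub>R\<^esub> \<in> jacobson_radical R" using J by (simp add: N.rsubmodule_iff)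
  ultimately show ?thesis unfolding semiprimitive_def by blast
qed


section \<open>Small injectivity and semiprimitivity\<close>

theorem corollary3p2:
  fixes R :: "('a, 'c) ring_scheme"
  assumes "ring R"
  shows "(\<forall>M :: ('a, 'b) rmodule.
           right_module R M \<longrightarrow> semisimple_rmodule R M \<longrightarrow>
           strongly_ss_injective R M \<longrightarrow> small_injective R M) \<and>
         ((\<forall>S :: ('a, 'a set) rmodule.
           right_module R S \<longrightarrow> simple_rmodule R S \<longrightarrow> strongly_ss_injective R S) \<longrightarrow>
          semiprimitive R)"
proof (intro conjI allI impI)
  fix M :: "('a, 'b) rmodule"
  assume "right_module R M" "semisimple_rmodule R M" "strongly_ss_injective R M"
  then show "small_injective R M" by (rule strongly_ss_injective_imp_small_injective)
next
  assume "\<forall>S :: ('a, 'a set) rmodule.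
    right_module R S \<longrightarrow> simple_rmodule R S \<longrightarrow> strongly_ss_injective R S"
  then show "semiprimitive R"
    using semiprimitive_if_simple_small_injective[OF assms]
      strongly_ss_injective_imp_small_injective simple_imp_semisimple by blast
qed

end
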